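(* Let $0<s<1$ and $1<p<\infty$, and suppose $u\in C_c^{\alpha}(\mathbb{R}^N)$ for some $\alpha>0$. Then for every $x\in\mathbb{R}^N$ the derivative $L_{\Delta_p}u(x):=\frac{d}{ds}\big|_{s=0}(-\Delta_p)^s u(x)$ exists and $$ \begin{aligned} L_{\Delta_p}u(x)&=C_{N,p}\int_{B_1(x)}\frac{|u(x)-u(y)|^{p-2}(u(x)-u(y))}{|x-y|^N}\,dy\\ &\quad+C_{N,p}\int_{\mathbb{R}^N\setminus B_1(x)}\frac{|u(x)-u(y)|^{p-2}(u(x)-u(y))-|u(x)|^{p-2}u(x)}{|x-y|^N}\,dy+\rho_N\,|u(x)|^{p-2}u(x), \end{aligned} $$ where $$ C_{N,p}:=\frac{p\,\Gamma(N/2)}{2\pi^{N/2}},\qquad \rho_N:=\rho_N(p):=2\ln 2-\gamma+\frac p2\,\psi\!\left(\frac N2\right). $$ Moreover, for every $1<q\le\infty$ we have $L_{\Delta_p}u\in L^q(\mathbb{R}^N)\cap C(\mathbb{R}^N)$ and $$ \frac{(-\Delta_p)^s u-|u|^{p-2}u}{s}\longrightarrow L_{\Delta_p}u\quad\text{in }L^q(\mathbb{R}^N)\text{ as }s\to0^+ . $$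
   Context: $N\in\mathbb{N}$, $\Gamma$ is the Gamma function, $\psi=\Gamma'/\Gamma$ the digamma function, $\gamma=-\Gamma'(1)$ the Euler–Mascheroni constant, $B_r(x)$ the open ball of radius $r$ around $x$, and $|a|^{p-2}a:=0$ for $a=0$. The fractional $p$-Laplacian is $$(-\Delta_p)^su(x)=C_{N,s,p}\,\mathrm{p.v.}\int_{\mathbb{R}^N}\frac{|u(x)-u(y)|^{p-2}(u(x)-u(y))}{|x-y|^{N+sp}}\,dy,$$ with normalization constant $$C_{N,s,p}=\frac{sp\,2^{2s-1}\,\Gamma\left(\frac{N+sp}{2}\right)}{\pi^{N/2}\,\Gamma(1-s)}\ \text{ if } s\le\tfrac12,\qquad C_{N,s,p}=\frac{sp\,2^{2s-2}\,\Gamma\left(\frac{N+sp}{2}\right)}{\pi^{\frac{N-1}{2}}\,\Gamma(1-s)\,\Gamma\left(\frac{p+1}{2}\right)}\ \text{ if } s>\tfrac12 .$$ For $u\in C_c^\alpha(\mathbb{R}^N)$ it is well defined at every point for all sufficiently small $s>0$, and $(-\Delta_p)^su(x)\to|u(x)|^{p-2}u(x)$ as $s\to0^+$. The derivative at $s=0$ is the one-sided derivative $$\frac{d}{ds}\Big|_{s=0}(-\Delta_p)^su(x)=\lim_{s\to0^+}\frac{(-\Delta_p)^su(x)-|u(x)|^{p-2}u(x)}{s}.$$ For $\alpha=k+\sigma$ with $k\in\mathbb{N}_0$ and $\sigma\in(0,1]$, $C_c^\alpha(\mathbb{R}^N)$ is the space of compactly supported, $k$-times continuously differentiable functions $\mathbb{R}^N\to\mathbb{R}$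 whose derivatives up to order $k$ are $\sigma$-Hölder continuous (Lipschitz if $\sigma=1$). *)

theory Defs
  imports "HOL-Analysis.Analysis" "HOL-Probability.Essential_Supremum"
begin

definition partial_deriv :: "'n::finite \<Rightarrow> (real^'n \<Rightarrow> real) \<Rightarrow> real^'n \<Rightarrow> real" where
  "partial_deriv i f = (\<lambda>x. frechet_derivative f (at x) (axis i 1))"

definition iter_partial :: "'n::finite list \<Rightarrow> (real^'n \<Rightarrow> real) \<Rightarrow> real^'n \<Rightarrow> real" where
  "iter_partial is f = foldr partial_deriv is f"

text \<open>Since \<^const>\<open>frechet_derivative\<close> is only meaningful for differentiable functions,
  differentiability of the derivatives of order below \<open>k\<close> is required explicitly.\<close>

definition k_times_cont_diff :: "nat \<Rightarrow> (real^'n::finite \<Rightarrow> real) \<Rightarrow> bool" where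
  "k_times_cont_diff k f \<longleftrightarrow>
     (\<forall>is. length is < k \<longrightarrow> iter_partial is f differentiable_on UNIV) \<and>
     (\<forall>is. length is \<le> k \<longrightarrow> continuous_on UNIV (iter_partial is f))"

definition holder_continuous :: "real \<Rightarrow> ('a::metric_space \<Rightarrow> real) \<Rightarrow> bool" where
  "holder_continuous \<sigma> f \<longleftrightarrow> (\<exists>C. \<forall>x y. \<bar>f x - f y\<bar> \<le> C * dist x y powr \<sigma>)"

text \<open>For \<open>\<alpha> > 0\<close> the decomposition \<open>\<alpha> = k + \<sigma>\<close> below exists and is unique.\<close>

definition Cc_holder :: "real \<Rightarrow> (real^'n::finite \<Rightarrow> real) set" where
  "Cc_holder \<alpha> = {u. compact (closure {x. u x \<noteq> 0}) \<and>
     (\<exists>k::nat. \<exists>\<sigma>. 0 < \<sigma> \<and> \<sigma> \<le> 1 \<and> \<alpha> = real k + \<sigma> \<and> k_times_cont_diff k u \<and>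
        (\<forall>is. length is \<le> k \<longrightarrow> holder_continuous \<sigma> (iter_partial is u)))}"

text \<open>\<open>|a|^(p-2) a\<close>; it is \<open>0\<close> at \<open>a = 0\<close> for every \<open>p\<close>.\<close>

definition signed_pow :: "real \<Rightarrow> real \<Rightarrow> real" where
  "signed_pow p a = \<bar>a\<bar> powr (p - 2) * a"

definition frac_const :: "nat \<Rightarrow> real \<Rightarrow> real \<Rightarrow> real" where
  "frac_const N s p =
     (if s \<le> 1/2
      then s * p * 2 powr (2 * s - 1) * Gamma ((real N + s * p) / 2)
             / (pi powr (real N / 2) * Gamma (1 - s))
      else s * p * 2 powr (2 * s - 2) * Gamma ((real N + s * p) / 2)
             / (pi powr ((real N - 1) / 2) * Gamma (1 - s) * Gamma ((p + 1) / 2)))"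

definition frac_integrand ::
    "real \<Rightarrow> real \<Rightarrow> (real^'n::finite \<Rightarrow> real) \<Rightarrow> real^'n \<Rightarrow> real^'n \<Rightarrow> real" where
  "frac_integrand s p u x y =
     signed_pow p (u x - u y) / norm (x - y) powr (real CARD('n) + s * p)"

definition frac_p_laplacian ::
    "real \<Rightarrow> real \<Rightarrow> (real^'n::finite \<Rightarrow> real) \<Rightarrow> real^'n \<Rightarrow> real" where
  "frac_p_laplacian s p u x =
     frac_const CARD('n) s p *
       Lim (at_right 0) (\<lambda>\<epsilon>. LINT y:(- ball x \<epsilon>)|lebesgue. frac_integrand s p u x y)"

text \<open>\<^const>\<open>Lim\<close> and the Bochner integral are total functions, so well-definedness of the
  principal value integral is a separate predicate.\<close>

definition frac_p_laplacian_exists ::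
    "real \<Rightarrow> real \<Rightarrow> (real^'n::finite \<Rightarrow> real) \<Rightarrow> real^'n \<Rightarrow> bool" where
  "frac_p_laplacian_exists s p u x \<longleftrightarrow>
     (\<forall>\<epsilon>>0. set_integrable lebesgue (- ball x \<epsilon>) (frac_integrand s p u x)) \<and>
     (\<exists>l. ((\<lambda>\<epsilon>. LINT y:(- ball x \<epsilon>)|lebesgue. frac_integrand s p u x y) \<longlongrightarrow> l) (at_right 0))"

definition frac_diff_quot ::
    "real \<Rightarrow> (real^'n::finite \<Rightarrow> real) \<Rightarrow> real \<Rightarrow> real^'n \<Rightarrow> real" where
  "frac_diff_quot p u s x = (frac_p_laplacian s p u x - signed_pow p (u x)) / s"

definition log_p_laplacian :: "real \<Rightarrow> (real^'n::finite \<Rightarrow> real) \<Rightarrow> real^'n \<Rightarrow> real" where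
  "log_p_laplacian p u x = Lim (at_right 0) (\<lambda>s. frac_diff_quot p u s x)"

definition log_const :: "nat \<Rightarrow> real \<Rightarrow> real" where
  "log_const N p = p * Gamma (real N / 2) / (2 * pi powr (real N / 2))"

definition rho_const :: "nat \<Rightarrow> real \<Rightarrow> real" where
  "rho_const N p = 2 * ln 2 - euler_mascheroni + p / 2 * Digamma (real N / 2)"

text \<open>The norm for \<open>1 \<le> q \<le> \<infinity>\<close>, with value \<open>\<infinity>\<close> allowed.\<close>

definition Lq_norm :: "ennreal \<Rightarrow> (real^'n::finite \<Rightarrow> real) \<Rightarrow> ennreal" where
  "Lq_norm q f =
     (if q = \<infinity> then esssup lebesgue (\<lambda>x. ennreal \<bar>f x\<bar>)
      else (let I = (\<integral>\<^sup>+x. ennreal (\<bar>f x\<bar> powr enn2real q) \<partial>lebesgue)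
            in if I = \<infinity> then \<infinity> else ennreal (enn2real I powr (1 / enn2real q))))"

definition Lq_space :: "ennreal \<Rightarrow> (real^'n::finite \<Rightarrow> real) set" where
  "Lq_space q = {f. f \<in> borel_measurable lebesgue \<and> Lq_norm q f < \<infinity>}"

definition tendsto_Lq ::
    "ennreal \<Rightarrow> ('b \<Rightarrow> real^'n::finite \<Rightarrow> real) \<Rightarrow> (real^'n \<Rightarrow> real) \<Rightarrow> 'b filter \<Rightarrow> bool" where
  "tendsto_Lq q F f A \<longleftrightarrow>
     (\<forall>\<^sub>F s in A. F s \<in> Lq_space q) \<and> f \<in> Lq_space q \<and>
     ((\<lambda>s. Lq_norm q (\<lambda>x. F s x - f x)) \<longlongrightarrow> 0) A"

end

theory Submission
  imports Defs
begin

text \<open>Let \<open>g(a) = |a|^(p-2) a\<close>, \<open>N = CARD('n)\<close> and let \<open>u\<close> be \<open>\<sigma>\<close>-Hoelder with support in the ball of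
  radius \<open>R\<close>; put \<open>\<beta> = \<sigma> (p - 1)\<close>. Since \<open>|g(u x - u y)| \<le> const |x - y|^\<beta>\<close>, the singularity of the
  kernel is absolutely integrable as soon as \<open>s p < \<beta>\<close>, so that for small \<open>s\<close> the principal value is an
  ordinary integral.

  The limit \<open>s \<rightarrow> 0\<close> is singular only because \<open>g(u x)\<close> has to be integrated over the unbounded set
  \<open>|x - y| \<ge> 1\<close>. This part is explicit: the integral of \<open>|z|^(-N-sp)\<close> over \<open>|z| \<ge> 1\<close> is
  \<open>N v / (s p)\<close>, where \<open>v\<close> is the volume of the unit ball. After subtracting it, one is left with
  the regularized increment \<open>g(u x - u (x+z)) - g(u x) [|z| \<ge> 1]\<close>, whose integral against
  \<open>|z|^(-N-t)\<close> (\<open>reg_potential t x\<close> below) converges even for \<open>t = 0\<close>: near \<open>z = 0\<close> by Hoelder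
  continuity, and far away because the increment vanishes unless \<open>x + z\<close> lies in the support.
  Writing the normalization constant as \<open>s c(s)\<close>, one has \<open>c(0) N v = p\<close>, and hence the exact formula
  (\<open>frac_diff_quot_eq\<close>): the difference quotient is
  \<open>c(s) reg_potential (s p) x + ((c(s)/c(0) - 1)/s) g(u x)\<close>. As \<open>s \<rightarrow> 0\<close>, the first coefficient tends
  to \<open>c(0)\<close>, which is the constant \<open>log_const\<close>, and the second to the logarithmic derivative of \<open>c\<close>
  at \<open>0\<close>, which is \<open>rho_const\<close>.

  For the convergence in \<open>L^q\<close>, everything is compared with the weights \<open>(1 + |x|)^(d - N)\<close>.
  The potential at \<open>t = 0\<close> is bounded by a multiple of \<open>(1 + |x|)^(-N)\<close>, which is in \<open>L^q\<close> exactly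
  for \<open>q > 1\<close>; replacing \<open>|z|^(-t)\<close> by \<open>1\<close> costs a logarithm, hence an arbitrarily small power \<open>d > 0\<close>. This gives
  (\<open>frac_diff_quot_rate\<close>) a bound \<open>\<epsilon>(s) (1 + |x|)^(d - N)\<close> with \<open>\<epsilon>(s) \<rightarrow> 0\<close> for the error, for each \<open>d\<close> in
  \<open>(0, N)\<close>. Given \<open>q > 1\<close>, a \<open>d\<close> with \<open>(N - d) q > N\<close> turns it into convergence in \<open>L^q\<close>
  (\<open>Lq_norm_le_decay\<close>); it also contains the pointwise limit.\<close>

section \<open>Radial integrals\<close>

text \<open>Integration in polar coordinates, for radial functions: the ball of radius \<open>a\<close> has volume
  \<open>v a^N\<close>, whose derivative is \<open>N v a^(N-1)\<close>, and a Borel measure on the line that is finite on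
  the rays \<open>{..a}\<close> is determined by its values there. The density is a real power,
  which is \<open>0\<close> at \<open>r = 0\<close> even in dimension one; this changes it on a null set only and lets the
  integrals of powers be applied without a case distinction.\<close>

lemma distr_norm_lborel:
  "distr lborel borel (norm :: 'a::euclidean_space \<Rightarrow> real) =
    density lborel (\<lambda>r. ennreal (indicator {0..} r * (DIM('a) * unit_ball_vol DIM('a) * r powr (real DIM('a) - 1))))"
    (is "?M = ?N")
proof (rule measure_eqI_generator_eq[where E = "range atMost" and \<Omega> = UNIV and A = "\<lambda>i. {..real i}"])
  let ?d = "real DIM('a)" and ?v = "unit_ball_vol (real DIM('a))"
  show "Int_stable (range (atMost :: real \<Rightarrow> real set))"
    by (auto simp: Int_stable_def)
  have d: "?d \<ge> 1"
    by (simp add: Suc_leI)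
  fix X :: "real set" assume "X \<in> range atMost"
  then obtain a where X: "X = {..a}" by auto
  show "emeasure ?M X = emeasure ?N X"
  proof (cases "a \<ge> 0")
    case True
    have "norm -` {..a} = cball (0::'a) a"
      by auto
    then have M: "emeasure ?M X = ennreal (?v * a ^ DIM('a))"
      using emeasure_cball[OF True, of "0::'a"] by (simp add: X emeasure_distr)
    have "((\<lambda>r. ?d * ?v * r powr (?d - 1)) has_integral ?d * ?v * (a powr (?d - 1 + 1) / (?d - 1 + 1))) {0..a}"
      using d True by (intro has_integral_mult_right has_integral_powr_from_0) auto
    also have "?d * ?v * (a powr (?d - 1 + 1) / (?d - 1 + 1)) = ?v * a ^ DIM('a)"
      using d True by (cases "a = 0") (auto simp: powr_realpow)
    finally have "((\<lambda>r. if r \<in> {0..a} then ?d * ?v * r powr (?d - 1) else 0) has_integral ?v * a ^ DIM('a)) UNIV"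
      by (subst has_integral_restrict_UNIV)
    then have "(\<integral>\<^sup>+r. ennreal (if r \<in> {0..a} then ?d * ?v * r powr (?d - 1) else 0) \<partial>lborel)
        = ennreal (?v * a ^ DIM('a))"
      by (intro nn_integral_has_integral_lborel) auto
    moreover have "ennreal (indicator {0..} r * (?d * ?v * r powr (?d - 1))) * indicator {..a} r
        = ennreal (if r \<in> {0..a} then ?d * ?v * r powr (?d - 1) else 0)" for r
      by (auto simp: indicator_def)
    ultimately show ?thesis
      unfolding M unfolding X by (subst emeasure_density) auto
  next
    case False
    then have "(norm :: 'a \<Rightarrow> real) -` {..a} = {}"
      by (auto simp: not_le dest: order_trans[OF norm_ge_zero])
    then have "emeasure ?M X = 0"
      by (simp add: X emeasure_distr)
    moreover have "emeasure ?N X = (\<integral>\<^sup>+r. 0 \<partial>(lborel :: real measure))"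
      unfolding X
      by (subst emeasure_density, simp, simp, intro nn_integral_cong)
        (use False in \<open>auto simp: indicator_def\<close>)
    ultimately show ?thesis
      by simp
  qed
next
  have "sets (borel :: real measure) = sigma_sets UNIV (range atMost)"
    by (subst borel_eq_atMost) auto
  then show "sets ?M = sigma_sets UNIV (range atMost)" "sets ?N = sigma_sets UNIV (range atMost)"
    by auto
  show "(\<Union>i. {..real i}) = UNIV"
    using real_arch_simple by auto
  fix i :: nat
  have "norm -` {..real i} = cball (0::'a) (real i)"
    by auto
  then show "emeasure ?M {..real i} \<noteq> \<infinity>"
    using emeasure_cball[of "real i" "0::'a"] by (simp add: emeasure_distr)
qed auto

lemma nn_integral_norm:
  fixes f :: "real \<Rightarrow> real"
  assumes [measurable]: "f \<in> borel_measurable borel" and f: "\<And>r. 0 \<le> f r"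
    and I: "((\<lambda>r. if 0 \<le> r then f r * r powr (real DIM('a) - 1) else 0) has_integral I) UNIV"
  shows "integral\<^sup>N lborel (\<lambda>z::'a::euclidean_space. ennreal (f (norm z)))
    = ennreal (DIM('a) * unit_ball_vol DIM('a) * I)"
proof -
  let ?d = "real DIM('a)" and ?v = "unit_ball_vol (real DIM('a))"
  have "integral\<^sup>N lborel (\<lambda>z::'a. ennreal (f (norm z)))
      = (\<integral>\<^sup>+r. ennreal (f r) \<partial>distr lborel borel (norm :: 'a \<Rightarrow> real))"
    by (subst nn_integral_distr) auto
  also have "\<dots> = (\<integral>\<^sup>+r. ennreal (indicator {0..} r * (?d * ?v * r powr (?d - 1))) * ennreal (f r) \<partial>lborel)"
    unfolding distr_norm_lborel by (subst nn_integral_density) auto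
  also have "\<dots> = (\<integral>\<^sup>+r. ennreal (?d * ?v * (if 0 \<le> r then f r * r powr (?d - 1) else 0)) \<partial>lborel)"
    by (intro nn_integral_cong) (auto simp: indicator_def f ac_simps simp flip: ennreal_mult)
  also have "\<dots> = ennreal (?d * ?v * I)"
    using f by (intro nn_integral_has_integral_lborel has_integral_mult_right I) (auto intro!: mult_nonneg_nonneg)
  finally show ?thesis .
qed

lemma has_bochner_integral_norm_powr_ball:
  fixes b :: real
  assumes "0 < b"
  shows "has_bochner_integral lborel
    (\<lambda>z::'a::euclidean_space. indicator (ball 0 1) z * norm z powr (b - DIM('a)))
    (DIM('a) * unit_ball_vol DIM('a) / b)"
proof -
  let ?d = "real DIM('a)" and ?v = "unit_ball_vol (real DIM('a))"
  let ?f = "\<lambda>r::real. indicator {..<1} r * r powr (b - ?d)"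
  have "((\<lambda>r. r powr (b - 1)) has_integral 1 powr (b - 1 + 1) / (b - 1 + 1)) {0..1}"
    using assms by (intro has_integral_powr_from_0) auto
  then have "((\<lambda>r. r powr (b - 1)) has_integral 1 / b) {0..1}"
    by simp
  then have "((\<lambda>r. if r \<in> {0..1} then r powr (b - 1) else 0) has_integral 1 / b) UNIV"
    by (subst has_integral_restrict_UNIV)
  then have "((\<lambda>r. if 0 \<le> r then ?f r * r powr (?d - 1) else 0) has_integral 1 / b) UNIV"
    by (rule has_integral_spike[of "{1}", rotated 2]) (auto simp: indicator_def simp flip: powr_add)
  then have "ennreal (?d * ?v * (1 / b)) = integral\<^sup>N lborel (\<lambda>z::'a. ennreal (?f (norm z)))"
    by (intro nn_integral_norm[symmetric]) auto
  also have "(\<lambda>z::'a. ennreal (?f (norm z))) = (\<lambda>z. ennreal (indicator (ball 0 1) z * norm z powr (b - DIM('a))))"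
    by (auto simp: indicator_def fun_eq_iff)
  finally show ?thesis
    using assms by (intro has_bochner_integral_nn_integral) (measurable, auto simp: mult_ac)
qed

text \<open>The exact value of this integral produces both the factor \<open>1/s\<close> that compensates the vanishing
  normalization constant and, together with the volume of the unit ball, the limit constant.\<close>

lemma has_bochner_integral_norm_powr_Compl_ball:
  fixes t :: real
  assumes "0 < t"
  shows "has_bochner_integral lborel
    (\<lambda>z::'a::euclidean_space. indicator (- ball 0 1) z * norm z powr (- (DIM('a) + t)))
    (DIM('a) * unit_ball_vol DIM('a) / t)"
proof -
  let ?d = "real DIM('a)" and ?v = "unit_ball_vol (real DIM('a))"
  let ?f = "\<lambda>r::real. indicator {1..} r * r powr (- (?d + t))"
  have "((\<lambda>r. r powr (- t - 1)) has_integral - (1 powr (- t - 1 + 1)) / (- t - 1 + 1)) {1..}"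
    using assms by (intro has_integral_powr_to_inf) auto
  then have "((\<lambda>r. r powr (- t - 1)) has_integral 1 / t) {1..}"
    by simp
  then have "((\<lambda>r. if r \<in> {1..} then r powr (- t - 1) else 0) has_integral 1 / t) UNIV"
    by (subst has_integral_restrict_UNIV)
  also have "(\<lambda>r. if r \<in> {1..} then r powr (- t - 1) else 0)
      = (\<lambda>r. if 0 \<le> r then ?f r * r powr (?d - 1) else 0)"
    by (auto simp: indicator_def fun_eq_iff simp flip: powr_add)
  finally have "ennreal (?d * ?v * (1 / t)) = integral\<^sup>N lborel (\<lambda>z::'a. ennreal (?f (norm z)))"
    by (intro nn_integral_norm[symmetric]) auto
  also have "(\<lambda>z::'a. ennreal (?f (norm z))) = (\<lambda>z. ennreal (indicator (- ball 0 1) z * norm z powr (- (DIM('a) + t))))"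
    by (auto simp: indicator_def fun_eq_iff)
  finally show ?thesis
    using assms by (intro has_bochner_integral_nn_integral) (measurable, auto simp: mult_ac)
qed

section \<open>Signed powers, power differences and principal values\<close>

lemma abs_signed_pow: "\<bar>signed_pow p a\<bar> = \<bar>a\<bar> powr (p - 1)"
proof (cases "a = 0")
  case False
  then have "\<bar>a\<bar> powr (p - 1) = \<bar>a\<bar> powr (p - 2) * \<bar>a\<bar> powr 1"
    by (simp only: flip: powr_add) simp
  then show ?thesis
    by (simp add: signed_pow_def abs_mult)
qed (simp add: signed_pow_def)

lemma signed_pow_0 [simp]: "signed_pow p 0 = 0"
  by (simp add: signed_pow_def)

lemma continuous_on_signed_pow [continuous_intros]:
  assumes "1 < p" "continuous_on S f"
  shows "continuous_on S (\<lambda>x. signed_pow p (f x))"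
proof -
  have "signed_pow p a = max a 0 powr (p - 1) - max (- a) 0 powr (p - 1)" for a
  proof (cases "a = 0")
    case False
    then have "\<bar>a\<bar> powr (p - 1) = \<bar>a\<bar> powr (p - 2) * \<bar>a\<bar> powr 1"
      by (simp only: flip: powr_add) simp
    then show ?thesis
      using False by (auto simp: signed_pow_def max_def abs_if)
  qed simp
  moreover have "continuous_on S (\<lambda>x. max (f x) 0 powr (p - 1) - max (- f x) 0 powr (p - 1))"
    using assms by (intro continuous_intros continuous_on_powr') auto
  ultimately show ?thesis
    by simp
qed

text \<open>Both estimates bound \<open>|r^(-t) - 1|\<close> by \<open>t |ln r|\<close>, up to the factor \<open>r^(-t)\<close> for \<open>r < 1\<close>, and then
  absorb the logarithm into a small power of \<open>r\<close>.\<close>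

lemma abs_powr_minus_one_le_small:
  fixes r t b :: real
  assumes "0 < r" "r < 1" "0 \<le> t" "0 < b"
  shows "\<bar>r powr (- t) - 1\<bar> \<le> t / b * r powr (- (t + b))"
proof -
  have "- ln r = ln (1 / r)" using assms by (simp add: ln_div)
  also have "\<dots> \<le> (1 / r) powr b / b" using assms by (intro ln_powr_bound) auto
  also have "\<dots> = r powr (- b) / b" using assms by (simp add: powr_divide powr_minus_divide)
  finally have 1: "- ln r \<le> r powr (- b) / b" .
  have "1 \<le> r powr (- t)"
    using assms powr_mono'[of "-t" 0 r] by simp
  then have "\<bar>r powr (- t) - 1\<bar> = r powr (-t) * (1 - exp (t * ln r))"
    using assms by (simp add: powr_def algebra_simps flip: exp_add)
  also have "\<dots> \<le> r powr (-t) * (t * (- ln r))"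
  proof (rule mult_left_mono)
    show "1 - exp (t * ln r) \<le> t * (- ln r)"
      using exp_ge_add_one_self[of "t * ln r"] by linarith
  qed simp
  also have "\<dots> \<le> r powr (-t) * (t * (r powr (- b) / b))"
    using 1 assms by (intro mult_left_mono) auto
  also have "\<dots> = t / b * r powr (- (t + b))"
    by (simp add: powr_add[symmetric] algebra_simps)
  finally show ?thesis .
qed

lemma abs_powr_minus_one_le_large:
  fixes r t b :: real
  assumes "1 \<le> r" "0 \<le> t" "0 < b"
  shows "\<bar>r powr (- t) - 1\<bar> \<le> t / b * r powr b"
proof -
  have "r powr (- t) \<le> 1"
    using assms powr_mono[of "-t" 0 r] by simp
  then have "\<bar>r powr (- t) - 1\<bar> = 1 - exp (- t * ln r)"
    using assms by (simp add: powr_def)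
  also have "\<dots> \<le> t * ln r"
    using exp_ge_add_one_self[of "- t * ln r"] by simp
  also have "\<dots> \<le> t * (r powr b / b)"
    using assms by (intro mult_left_mono ln_powr_bound) auto
  finally show ?thesis by simp
qed

lemma has_bochner_integral_lebesgue_translate:
  fixes f :: "'a::euclidean_space \<Rightarrow> real"
  assumes [measurable]: "f \<in> borel_measurable borel"
    and "has_bochner_integral lborel (\<lambda>z. f (x + z)) I"
  shows "has_bochner_integral lebesgue f I"
proof -
  have "has_bochner_integral (distr lborel borel ((+) x)) f I"
    using assms by (intro has_bochner_integral_distr) auto
  then show ?thesis
    by (simp add: lborel_distr_plus has_bochner_integral_iff integrable_completion integral_completion)
qed

lemma principal_value_integrable:
  fixes f :: "'a::euclidean_space \<Rightarrow> real"
  assumes f: "integrable lebesgue f"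
  shows "set_integrable lebesgue (- ball x e) f"
    and "((\<lambda>e. LINT y:(- ball x e)|lebesgue. f y) \<longlongrightarrow> (LINT y|lebesgue. f y)) (at_right 0)"
proof -
  have [measurable]: "f \<in> borel_measurable lebesgue"
    using f by auto
  show si: "set_integrable lebesgue (- ball x e) f" for e
    unfolding set_integrable_def using f by (intro integrable_mult_indicator) auto
  show "((\<lambda>e. LINT y:(- ball x e)|lebesgue. f y) \<longlongrightarrow> (LINT y|lebesgue. f y)) (at_right 0)"
  \<comment> \<open>The deleted balls shrink to a single point, which is a null set.\<close>
  proof (rule tendsto_at_right_sequentially[of _ 1])
    fix S :: "nat \<Rightarrow> real" assume S: "\<And>n. 0 < S n" "S \<longlonglongrightarrow> 0"
    show "(\<lambda>n. LINT y:(- ball x (S n))|lebesgue. f y) \<longlonglongrightarrow> (LINT y|lebesgue. f y)"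
      unfolding set_lebesgue_integral_def
    proof (rule integral_dominated_convergence)
      have "AE y in lebesgue. y \<noteq> x"
        by (rule AE_I'[of "{x}"]) auto
      then show "AE y in lebesgue. (\<lambda>n. indicator (- ball x (S n)) y *\<^sub>R f y) \<longlonglongrightarrow> f y"
      proof eventually_elim
        case (elim y)
        then have "\<forall>\<^sub>F n in sequentially. S n < dist x y"
          using S(2) by (intro order_tendstoD) auto
        then show ?case
          by (intro tendsto_eventually, eventually_elim) (simp add: indicator_def)
      qed
      show "integrable lebesgue (\<lambda>y. norm (f y))"
        using f by simp
      show "(\<lambda>y. indicator (- ball x (S n)) y *\<^sub>R f y) \<in> borel_measurable lebesgue" for n
        using si[of "S n"] unfolding set_integrable_def by auto
    qed (auto simp: indicator_def)
  qed simp
qed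

section \<open>Norms in \<open>L^q\<close> of functions with power decay\<close>

lemma integrable_one_plus_norm_powr:
  fixes a :: real
  assumes "a > DIM('a)"
  shows "integrable lborel (\<lambda>x::'a::euclidean_space. (1 + norm x) powr (- a))"
proof (rule Bochner_Integration.integrable_bound)
  let ?w = "\<lambda>x::'a. indicator (ball 0 1) x + indicator (- ball 0 1) x * norm x powr (- (DIM('a) + (a - DIM('a))))"
  show "integrable lborel ?w"
    using has_bochner_integral_norm_powr_Compl_ball[of "a - DIM('a)", where 'a='a] assms
    by (intro Bochner_Integration.integrable_add)
      (auto simp: has_bochner_integral_iff emeasure_ball integrable_indicator_iff)
  have "(1 + norm x) powr (- a) \<le> ?w x" for x
  proof (cases "norm x < 1")
    case True
    have "(1 + norm x) powr (- a) \<le> (1 + norm x) powr 0"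
      using assms by (intro powr_mono) auto
    also have "\<dots> = 1"
      using norm_ge_zero[of x] by (simp del: norm_ge_zero)
    finally show ?thesis using True by simp
  next
    case False
    have "(1 + norm x) powr (- a) \<le> norm x powr (- a)"
      using assms False by (intro powr_mono2') auto
    then show ?thesis using False by simp
  qed
  then show "AE x in lborel. norm ((1 + norm x) powr (- a)) \<le> norm (?w x)"
    by (intro AE_I2) (simp add: abs_of_nonneg)
qed auto

text \<open>A decay rate that is a little slower than \<open>|x|^(-N)\<close> suffices for each \<open>q > 1\<close>, and neither
  the rate nor the constant depends on the function, so that a scalar factor tending to \<open>0\<close> yields convergence in norm.\<close>

lemma Lq_norm_le_decay:
  fixes q :: ennreal
  assumes "1 < q"
  obtains d K :: real where "0 < d" "d < CARD('n)" "0 \<le> K"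
    "\<And>e (f :: real^'n::finite \<Rightarrow> real). f \<in> borel_measurable lebesgue \<Longrightarrow> 0 \<le> e
      \<Longrightarrow> (\<And>x. \<bar>f x\<bar> \<le> e * (1 + norm x) powr (d - CARD('n))) \<Longrightarrow> Lq_norm q f \<le> ennreal (K * e)"
proof (cases "q = \<infinity>")
  case True
  show thesis
  proof (rule that[of "real CARD('n) / 2" 1])
    fix e and f :: "real^'n \<Rightarrow> real"
    assume [measurable]: "f \<in> borel_measurable lebesgue" and "0 \<le> e"
      and f: "\<And>x. \<bar>f x\<bar> \<le> e * (1 + norm x) powr (real CARD('n) / 2 - CARD('n))"
    have "\<bar>f x\<bar> \<le> e" for x
    proof -
      have "(1 + norm x) powr (real CARD('n) / 2 - CARD('n)) \<le> (1 + norm x) powr 0"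
        by (intro powr_mono) auto
      also have "\<dots> = 1"
        using norm_ge_zero[of x] by (simp del: norm_ge_zero)
      finally have "e * (1 + norm x) powr (real CARD('n) / 2 - CARD('n)) \<le> e * 1"
        using \<open>0 \<le> e\<close> by (intro mult_left_mono)
      with f[of x] show ?thesis
        by simp
    qed
    then have "esssup lebesgue (\<lambda>x. ennreal \<bar>f x\<bar>) \<le> ennreal e"
      by (intro esssup_I AE_I2 ennreal_leI) auto
    then show "Lq_norm q f \<le> ennreal (1 * e)"
      using True by (simp add: Lq_norm_def)
  qed auto
next
  case False
  define Q where "Q = enn2real q"
  have "q = ennreal Q"
    using False by (simp add: Q_def less_top)
  with assms have Q: "1 < Q"
    by (metis ennreal_1 ennreal_less_iff zero_le_one)
  \<comment> \<open>This makes \<open>(N - d) Q\<close> the midpoint of \<open>N\<close> and \<open>N Q\<close>.\<close>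
  define d where "d = real CARD('n) * (Q - 1) / (2 * Q)"
  have d: "(real CARD('n) - d) * Q = real CARD('n) * ((Q + 1) / 2)"
    using Q by (simp add: d_def field_simps)
  have dN: "(real CARD('n) - d) * Q > real CARD('n)"
    unfolding d using Q by simp
  define W where "W x = (1 + norm x) powr ((d - CARD('n)) * Q)" for x :: "real^'n"
  define J where "J = (LINT x|lborel. W x)"
  have [measurable]: "W \<in> borel_measurable borel"
    unfolding W_def by measurable
  have W: "integrable lborel W"
    using integrable_one_plus_norm_powr[where 'a="real^'n", of "(real CARD('n) - d) * Q"] dN
    by (simp add: W_def[abs_def] algebra_simps)
  have W_nonneg: "0 \<le> W x" for x
    by (simp add: W_def)
  have J: "0 \<le> J"
    unfolding J_def by (simp add: W_nonneg)
  show thesis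
  proof (rule that[of d "J powr (1 / Q)"])
    show "0 < d"
      using Q by (simp add: d_def)
    show "d < real CARD('n)"
      using Q dN by (smt (verit, best) mult_nonneg_nonneg mult_nonpos_nonneg of_nat_0_le_iff)
    show "0 \<le> J powr (1 / Q)"
      by simp
    fix e and f :: "real^'n \<Rightarrow> real"
    assume [measurable]: "f \<in> borel_measurable lebesgue" and e: "0 \<le> e"
      and f: "\<And>x. \<bar>f x\<bar> \<le> e * (1 + norm x) powr (d - CARD('n))"
    have "\<bar>f x\<bar> powr Q \<le> e powr Q * W x" for x
    proof -
      have "\<bar>f x\<bar> powr Q \<le> (e * (1 + norm x) powr (d - CARD('n))) powr Q"
        using Q by (intro powr_mono2 f) auto
      then show ?thesis
        using e by (simp add: W_def powr_mult powr_powr)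
    qed
    then have "(\<integral>\<^sup>+x. ennreal (\<bar>f x\<bar> powr Q) \<partial>lebesgue) \<le> (\<integral>\<^sup>+x. ennreal (e powr Q * W x) \<partial>lebesgue)"
      by (intro nn_integral_mono ennreal_leI)
    also have "\<dots> = (\<integral>\<^sup>+x. ennreal (e powr Q * W x) \<partial>lborel)"
      by (intro nn_integral_completion)
    also have "\<dots> = ennreal (e powr Q * J)"
      using W unfolding J_def
      by (subst nn_integral_eq_integral) (auto simp: W_nonneg)
    finally have I: "(\<integral>\<^sup>+x. ennreal (\<bar>f x\<bar> powr Q) \<partial>lebesgue) \<le> ennreal (e powr Q * J)" (is "?I \<le> _") .
    then have fin: "?I \<noteq> \<infinity>"
      by (auto simp: top_unique)
    have "enn2real ?I powr (1 / Q) \<le> (e powr Q * J) powr (1 / Q)"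
      using I J Q by (intro powr_mono2 enn2real_leI) auto
    also have "\<dots> = J powr (1 / Q) * e"
      using e J Q by (simp add: powr_mult powr_powr)
    finally show "Lq_norm q f \<le> ennreal (J powr (1 / Q) * e)"
      using False fin by (auto simp: Lq_norm_def Let_def Q_def intro!: ennreal_leI)
  qed
qed

section \<open>The normalization constant\<close>

text \<open>The factor \<open>c(s)\<close> in the normalization constant \<open>s c(s)\<close>, in the form that is valid for
  \<open>s \<le> 1/2\<close>. Unlike the normalization constant it has a nonzero value at \<open>s = 0\<close>.\<close>

definition frac_coeff :: "nat \<Rightarrow> real \<Rightarrow> real \<Rightarrow> real" where
  "frac_coeff N p s = p * 2 powr (2 * s - 1) * Gamma ((real N + s * p) / 2) / (pi powr (real N / 2) * Gamma (1 - s))"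

lemma frac_coeff_0: "frac_coeff N p 0 = log_const N p"
  by (simp add: frac_coeff_def log_const_def powr_minus field_simps)

text \<open>The three summands of \<open>rho_const\<close> are the logarithmic derivatives at \<open>0\<close> of the three factors of
  \<open>c\<close> that depend on \<open>s\<close>: \<open>2^(2s)\<close> gives \<open>2 ln 2\<close>, the Gamma function in the numerator gives
  \<open>p/2\<close> times the digamma value, and \<open>1/\<Gamma>(1-s)\<close> gives \<open>\<psi>(1) = -\<gamma>\<close>.\<close>

lemma DERIV_frac_coeff:
  assumes "0 < N"
  shows "(frac_coeff N p has_real_derivative log_const N p * rho_const N p) (at 0)"
proof -
  have N: "real N / 2 \<notin> \<int>\<^sub>\<le>\<^sub>0"
    using assms by (auto dest: nonpos_Ints_nonpos)
  have Gpos: "Gamma (real N / 2) > 0"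
    using assms by (intro Gamma_real_pos) auto
  have 1: "((\<lambda>s. Gamma ((real N + s * p) / 2)) has_real_derivative
      Gamma (real N / 2) * Digamma (real N / 2) * (p / 2)) (at 0)"
    using N by (auto intro!: derivative_eq_intros)
  have 2: "((\<lambda>s. Gamma (1 - s)) has_real_derivative euler_mascheroni) (at (0::real))"
    by (auto intro!: derivative_eq_intros simp: Digamma_1)
  have 3: "((\<lambda>s. 2 powr (2 * s - 1)) has_real_derivative ln 2) (at (0::real))"
    by (auto intro!: derivative_eq_intros simp: powr_minus)
  have "((\<lambda>s. p * 2 powr (2 * s - 1) * Gamma ((real N + s * p) / 2) / (pi powr (real N / 2) * Gamma (1 - s)))
      has_real_derivative log_const N p * rho_const N p) (at 0)"
    by (rule DERIV_cong[OF DERIV_divide[OF DERIV_mult[OF DERIV_cmult[OF 3] 1] DERIV_cmult[OF 2]]])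
      (simp_all add: log_const_def rho_const_def powr_minus field_simps power2_eq_square)
  then show ?thesis
    by (simp add: frac_coeff_def[abs_def])
qed

text \<open>The surface area of the unit sphere is \<open>N v = 2 \<pi>^(N/2) / \<Gamma>(N/2)\<close>, so that \<open>log_const\<close> is \<open>p\<close>
  divided by it. This identity is the reason why the operators converge to \<open>g(u x)\<close>.\<close>

lemma log_const_surface:
  assumes "0 < N"
  shows "log_const N p * (real N * unit_ball_vol (real N)) = p"
proof -
  have "Gamma (real N / 2 + 1) = real N / 2 * Gamma (real N / 2)"
    using assms by (intro Gamma_plus1) (auto dest: nonpos_Ints_nonpos)
  moreover have "Gamma (real N / 2) \<noteq> 0"
    using assms by (intro less_imp_neq[symmetric] Gamma_real_pos) simp
  ultimately show ?thesis
    using assms by (simp add: log_const_def unit_ball_vol_def field_simps)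
qed

section \<open>Regularized increments of a Hoelder function\<close>

locale holder_compact_support =
  fixes u :: "real^'n::finite \<Rightarrow> real" and p \<sigma> C R :: real
  assumes p_gt_1: "1 < p" and sigma_pos: "0 < \<sigma>" and C_nonneg: "0 \<le> C" and R_pos: "0 < R"
    and holder: "\<bar>u x - u y\<bar> \<le> C * dist x y powr \<sigma>"
    and zero_outside: "R < norm x \<Longrightarrow> u x = 0"
begin

text \<open>The Hoelder exponent of the increments \<open>g(u x - u y)\<close>: it measures how far the order of the
  singularity stays below \<open>N\<close>.\<close>

definition \<beta> :: real where "\<beta> = \<sigma> * (p - 1)"

lemma beta_pos: "0 < \<beta>"
  using p_gt_1 sigma_pos by (simp add: \<beta>_def)

lemma continuous_u: "continuous_on UNIV u"
  unfolding continuous_on_eq_continuous_within continuous_within Lim_null[where l = "u _"]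
proof
  fix x :: "real^'n"
  have "((\<lambda>y. C * dist y x powr \<sigma>) \<longlongrightarrow> C * dist x x powr \<sigma>) (at x)"
    using sigma_pos by (intro tendsto_intros tendsto_powr') auto
  then have "((\<lambda>y. C * dist y x powr \<sigma>) \<longlongrightarrow> 0) (at x)"
    by simp
  then show "((\<lambda>y. u y - u x) \<longlongrightarrow> 0) (at x)"
    by (rule Lim_null_comparison[rotated]) (simp add: holder)
qed

lemma measurable_u [measurable]: "u \<in> borel_measurable borel"
  using continuous_u by (rule borel_measurable_continuous_onI)

lemma measurable_signed_pow [measurable]: "signed_pow p \<in> borel_measurable borel"
  by (intro borel_measurable_continuous_onI continuous_intros p_gt_1)

text \<open>Outside the unit ball the constant \<open>g(u x)\<close> is removed, which is the value of
  \<open>g(u x - u (x + z))\<close> wherever \<open>x + z\<close> is outside the support of \<open>u\<close>.\<close>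

definition reg_incr :: "real^'n \<Rightarrow> real^'n \<Rightarrow> real" where
  "reg_incr x z = signed_pow p (u x - u (x + z)) - (if norm z < 1 then 0 else signed_pow p (u x))"

lemma measurable_reg_incr [measurable]: "reg_incr x \<in> borel_measurable borel"
  unfolding reg_incr_def by measurable

lemma bounded_u: obtains U where "0 \<le> U" "\<And>x. \<bar>u x\<bar> \<le> U"
proof
  show "0 \<le> \<bar>u 0\<bar> + C * R powr \<sigma>"
    using C_nonneg by simp
  show "\<bar>u x\<bar> \<le> \<bar>u 0\<bar> + C * R powr \<sigma>" for x
  proof (cases "norm x \<le> R")
    case True
    have "\<bar>u x - u 0\<bar> \<le> C * norm x powr \<sigma>"
      using holder[of x 0] by simp
    also have "\<dots> \<le> C * R powr \<sigma>"
      using True C_nonneg sigma_pos by (intro mult_left_mono powr_mono2) auto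
    finally show ?thesis
      by linarith
  qed (use zero_outside[of x] C_nonneg in simp)
qed

text \<open>Hoelder continuity gives the power of \<open>|z|\<close> for small \<open>z\<close>. The case distinctions record the
  supports: if \<open>|z| < 1\<close> and \<open>|x| > R + 1\<close>, then \<open>u\<close> vanishes at both \<open>x\<close> and \<open>x + z\<close>, and if
  \<open>|z| \<ge> 1\<close> and \<open>|x + z| > R\<close>, then the two terms of the regularized increment cancel.\<close>

lemma reg_incr_bound:
  obtains A where "0 \<le> A"
    "\<And>x z. norm z < 1 \<Longrightarrow> \<bar>reg_incr x z\<bar> \<le> (if norm x \<le> R + 1 then A * norm z powr \<beta> else 0)"
    "\<And>x z. 1 \<le> norm z \<Longrightarrow> \<bar>reg_incr x z\<bar> \<le> (if norm (x + z) \<le> R then A else 0)"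
proof -
  obtain U where U: "0 \<le> U" "\<And>x. \<bar>u x\<bar> \<le> U"
    using bounded_u by blast
  define A where "A = C powr (p - 1) + (2 * U) powr (p - 1) + U powr (p - 1)"
  show thesis
  proof
    show "0 \<le> A"
      by (simp add: A_def)
    fix x z :: "real^'n"
    {
      assume z: "norm z < 1"
      show "\<bar>reg_incr x z\<bar> \<le> (if norm x \<le> R + 1 then A * norm z powr \<beta> else 0)"
      proof (cases "norm x \<le> R + 1")
        case True
        have "\<bar>reg_incr x z\<bar> = \<bar>u x - u (x + z)\<bar> powr (p - 1)"
          using z by (simp add: reg_incr_def abs_signed_pow)
        also have "\<dots> \<le> (C * norm z powr \<sigma>) powr (p - 1)"
          using holder[of x "x + z"] p_gt_1 by (intro powr_mono2) (auto simp: dist_norm)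
        also have "\<dots> = C powr (p - 1) * norm z powr \<beta>"
          using C_nonneg by (simp add: powr_mult powr_powr \<beta>_def)
        also have "\<dots> \<le> A * norm z powr \<beta>"
          by (intro mult_right_mono) (auto simp: A_def)
        finally show ?thesis
          using True by simp
      next
        case False
        then have "R < norm (x + z)"
          using z norm_diff_ineq[of x z] by linarith
        then show ?thesis
          using False z by (simp add: reg_incr_def zero_outside)
      qed
    next
      assume z: "1 \<le> norm z"
      show "\<bar>reg_incr x z\<bar> \<le> (if norm (x + z) \<le> R then A else 0)"
      proof (cases "norm (x + z) \<le> R")
        case True
        have "\<bar>reg_incr x z\<bar> \<le> \<bar>u x - u (x + z)\<bar> powr (p - 1) + \<bar>u x\<bar> powr (p - 1)"
          using z abs_triangle_ineq4[of "signed_pow p (u x - u (x + z))" "signed_pow p (u x)"]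
          by (simp add: reg_incr_def abs_signed_pow)
        also have "\<dots> \<le> (2 * U) powr (p - 1) + U powr (p - 1)"
          using U(2)[of x] U(2)[of "x + z"] p_gt_1 by (intro add_mono powr_mono2) auto
        also have "\<dots> \<le> A"
          by (simp add: A_def)
        finally show ?thesis
          using True by simp
      next
        case False
        then show ?thesis
          using z by (simp add: reg_incr_def zero_outside)
      qed
    }
  qed
qed

text \<open>Radial weights that are no worse than \<open>|z|^(-N-\<beta>/2)\<close> near the origin, which leaves an integrable
  singularity \<open>|z|^(\<beta>/2-N)\<close> after multiplication by the increment, and no worse than \<open>|z|^(d-N)\<close>
  at infinity, which is what determines the decay in \<open>x\<close>.\<close>

definition weight_le :: "real \<Rightarrow> real \<Rightarrow> (real \<Rightarrow> real) \<Rightarrow> bool" where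
  "weight_le d c w \<longleftrightarrow> w \<in> borel_measurable borel \<and> 0 \<le> c \<and>
    (\<forall>r. 0 < r \<and> r < 1 \<longrightarrow> \<bar>w r\<bar> \<le> c * r powr (- (real CARD('n) + \<beta> / 2))) \<and>
    (\<forall>r\<ge>1. \<bar>w r\<bar> \<le> c * r powr (d - real CARD('n)))"

text \<open>The main estimate, used for the weights \<open>|z|^(-N-t)\<close> and for their differences. Far from the support
  of \<open>u\<close>, only those \<open>z\<close> contribute for which \<open>x + z\<close> is in the ball of radius \<open>R\<close>; for them \<open>|z|\<close> is
  comparable to \<open>1 + |x|\<close>, so the weight can be taken out of the integral, which then runs over a set
  of fixed volume.\<close>

lemma reg_incr_weight_integral:
  fixes d :: real
  assumes "0 \<le> d" "d < CARD('n)"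
  obtains B :: real where "0 \<le> B"
    "\<And>w c x. weight_le d c w \<Longrightarrow> integrable lborel (\<lambda>z. reg_incr x z * w (norm z))"
    "\<And>w c x. weight_le d c w \<Longrightarrow>
      \<bar>LINT z|lborel. reg_incr x z * w (norm z)\<bar> \<le> c * B * (1 + norm x) powr (d - real CARD('n))"
proof -
  let ?N = "real CARD('n)" and ?v = "unit_ball_vol (real CARD('n))"
  obtain A where A: "0 \<le> A"
    "\<And>x z. norm z < 1 \<Longrightarrow> \<bar>reg_incr x z\<bar> \<le> (if norm x \<le> R + 1 then A * norm z powr \<beta> else 0)"
    "\<And>x z. 1 \<le> norm z \<Longrightarrow> \<bar>reg_incr x z\<bar> \<le> (if norm (x + z) \<le> R then A else 0)"
    using reg_incr_bound by blast
  define D where "D = A * (2 + R) powr ?N"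
  have D: "0 \<le> D"
    using A(1) by (simp add: D_def)
  \<comment> \<open>A majorant whose integral does not depend on \<open>x\<close>: the singularity at the origin, and the
    indicator function of the set of \<open>z\<close> with \<open>|x + z| \<le> R\<close>.\<close>
  define m where "m x z = indicator (ball 0 1) z * norm z powr (\<beta> / 2 - ?N) + indicator (cball (- x) R) z"
    for x z :: "real^'n"
  have m: "has_bochner_integral lborel (m x) (?N * ?v / (\<beta> / 2) + ?v * R ^ CARD('n))" for x
  proof -
    have "has_bochner_integral lborel (indicator (cball (- x) R) :: real^'n \<Rightarrow> real) (measure lborel (cball (- x) R))"
      using emeasure_cball[of R "- x"] R_pos by (intro has_bochner_integral_real_indicator) auto
    moreover have "measure lborel (cball (- x) R) = ?v * R ^ CARD('n)"
      using content_cball[of R "- x"] R_pos by simp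
    ultimately show ?thesis
      using has_bochner_integral_norm_powr_ball[of "\<beta> / 2", where 'a="real^'n"] beta_pos
      unfolding m_def by (intro has_bochner_integral_add) auto
  qed
  have bound: "\<bar>reg_incr x z * w (norm z)\<bar> \<le> c * (1 + norm x) powr (d - ?N) * D * m x z"
    if c: "0 \<le> c" and w1: "\<And>r. 0 < r \<Longrightarrow> r < 1 \<Longrightarrow> \<bar>w r\<bar> \<le> c * r powr (- (?N + \<beta> / 2))"
      and w2: "\<And>r. 1 \<le> r \<Longrightarrow> \<bar>w r\<bar> \<le> c * r powr (d - ?N)" for w c x z
  proof -
    have m0: "0 \<le> m x z"
      by (simp add: m_def)
    consider "z = 0" | "z \<noteq> 0" "norm z < 1" "norm x \<le> R + 1" | "norm z < 1" "norm x > R + 1"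
      | "1 \<le> norm z" "norm (x + z) \<le> R" | "1 \<le> norm z" "norm (x + z) > R"
      by linarith
    then show ?thesis
    proof cases
      case 1
      then show ?thesis
        using c D m0 by (simp add: reg_incr_def)
    next
      case 2
      \<comment> \<open>Here \<open>1 + |x| \<le> 2 + R\<close>, so the decay factor is bounded below and the power of \<open>2 + R\<close> in
        \<open>D\<close> compensates for it.\<close>
      have "1 \<le> (2 + R) powr d"
        using assms R_pos by (intro ge_one_powr_ge_zero) auto
      also have "\<dots> = (2 + R) powr (d - ?N) * (2 + R) powr ?N"
        by (simp flip: powr_add)
      also have "\<dots> \<le> (1 + norm x) powr (d - ?N) * (2 + R) powr ?N"
        using 2 assms by (intro mult_right_mono powr_mono2') (auto intro: add_pos_nonneg)
      finally have W: "1 \<le> (1 + norm x) powr (d - ?N) * (2 + R) powr ?N" .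
      have "\<bar>reg_incr x z * w (norm z)\<bar> \<le> (A * norm z powr \<beta>) * (c * norm z powr (- (?N + \<beta> / 2)))"
        unfolding abs_mult using A(2)[of z x] w1[of "norm z"] 2 A(1) by (intro mult_mono) auto
      also have "\<dots> = c * 1 * A * norm z powr (\<beta> / 2 - ?N)"
        by (simp flip: powr_add)
      also have "\<dots> \<le> c * ((1 + norm x) powr (d - ?N) * (2 + R) powr ?N) * A * m x z"
        using c A(1) W 2 by (intro mult_mono) (auto simp: m_def)
      finally show ?thesis
        by (simp add: D_def mult_ac)
    next
      case 3
      then have "reg_incr x z = 0"
        using A(2)[of z x] by simp
      then show ?thesis
        using c D m0 by simp
    next
      case 4
      \<comment> \<open>Since \<open>|z| \<ge> 1\<close>, one gets \<open>1 + |x| \<le> (2 + R) |z|\<close>, and negative powers reverse this.\<close>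
      have "norm x \<le> norm (x + z) + norm z"
        using norm_triangle_ineq4[of "x + z" z] by simp
      also have "\<dots> \<le> R * norm z + norm z"
        using 4 mult_left_mono[OF 4(1) less_imp_le[OF R_pos]] by simp
      finally have "1 + norm x \<le> (2 + R) * norm z"
        using 4 by (simp add: algebra_simps)
      then have "((2 + R) * norm z) powr (d - ?N) \<le> (1 + norm x) powr (d - ?N)"
        using assms by (intro powr_mono2') (auto intro: add_pos_nonneg)
      then have "norm z powr (d - ?N) * (2 + R) powr (d - ?N) * (2 + R) powr ?N
          \<le> (1 + norm x) powr (d - ?N) * (2 + R) powr ?N"
        using R_pos by (intro mult_right_mono) (auto simp: powr_mult mult_ac)
      also have "norm z powr (d - ?N) * (2 + R) powr (d - ?N) * (2 + R) powr ?N = norm z powr (d - ?N) * (2 + R) powr d"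
        by (simp add: mult.assoc flip: powr_add)
      finally have "norm z powr (d - ?N) * (2 + R) powr d \<le> (1 + norm x) powr (d - ?N) * (2 + R) powr ?N" .
      moreover have "norm z powr (d - ?N) * 1 \<le> norm z powr (d - ?N) * (2 + R) powr d"
        using assms R_pos by (intro mult_left_mono ge_one_powr_ge_zero) auto
      ultimately have W: "norm z powr (d - ?N) \<le> (1 + norm x) powr (d - ?N) * (2 + R) powr ?N"
        by simp
      have zm: "1 \<le> m x z"
        using 4 by (simp add: m_def indicator_def dist_norm norm_minus_commute add.commute)
      have "\<bar>reg_incr x z * w (norm z)\<bar> \<le> A * (c * norm z powr (d - ?N))"
        unfolding abs_mult using A(3)[of z x] w2[of "norm z"] 4 A(1) by (intro mult_mono) auto
      also have "\<dots> = c * norm z powr (d - ?N) * A * 1"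
        by simp
      also have "\<dots> \<le> c * ((1 + norm x) powr (d - ?N) * (2 + R) powr ?N) * A * m x z"
        using c A(1) W zm by (intro mult_mono mult_nonneg_nonneg) auto
      finally show ?thesis
        by (simp add: D_def mult_ac)
    next
      case 5
      then have "reg_incr x z = 0"
        using A(3)[of z x] by simp
      then show ?thesis
        using c D m0 by simp
    qed
  qed
  define B where "B = D * (?N * ?v / (\<beta> / 2) + ?v * R ^ CARD('n))"
  have *: "integrable lborel (\<lambda>z. reg_incr x z * w (norm z)) \<and>
      \<bar>LINT z|lborel. reg_incr x z * w (norm z)\<bar> \<le> c * B * (1 + norm x) powr (d - ?N)"
    if weight: "weight_le d c w" for w c x
  proof -
    have [measurable]: "w \<in> borel_measurable borel" and c: "0 \<le> c"
      and w: "\<And>r. 0 < r \<Longrightarrow> r < 1 \<Longrightarrow> \<bar>w r\<bar> \<le> c * r powr (- (?N + \<beta> / 2))"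
        "\<And>r. 1 \<le> r \<Longrightarrow> \<bar>w r\<bar> \<le> c * r powr (d - ?N)"
      using weight by (auto simp: weight_le_def)
    let ?m = "\<lambda>z. c * (1 + norm x) powr (d - ?N) * D * m x z"
    have im: "integrable lborel ?m"
      using m[of x] by (auto simp: has_bochner_integral_iff)
    have ik: "integrable lborel (\<lambda>z. reg_incr x z * w (norm z))"
    proof (rule Bochner_Integration.integrable_bound[OF im])
      show "AE z in lborel. norm (reg_incr x z * w (norm z)) \<le> norm (?m z)"
        using order_trans[OF bound[OF c w] abs_ge_self] by (intro AE_I2) simp
    qed measurable
    have "\<bar>LINT z|lborel. reg_incr x z * w (norm z)\<bar> \<le> (LINT z|lborel. ?m z)"
      using bound[OF c w, of x] by (intro Bochner_Integration.integral_abs_bound_integral ik im) auto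
    also have "\<dots> = c * B * (1 + norm x) powr (d - ?N)"
      using m[of x] by (simp add: has_bochner_integral_iff B_def)
    finally show ?thesis
      using ik by simp
  qed
  have "0 \<le> B"
    using D beta_pos R_pos by (simp add: B_def)
  with * show thesis
    by (intro that[of B]) auto
qed

section \<open>The regularized potential\<close>

text \<open>For \<open>t = s p\<close> with \<open>s > 0\<close> this is the integral that defines the fractional operator, freed of the
  part that diverges as \<open>s \<rightarrow> 0\<close>; for \<open>t = 0\<close> it is the sum of the two integrals in the logarithmic operator.\<close>

definition reg_potential :: "real \<Rightarrow> real^'n \<Rightarrow> real" where
  "reg_potential t x = (LINT z|lborel. reg_incr x z * norm z powr (- (real CARD('n) + t)))"

lemma reg_potential_bound:
  fixes d :: real
  assumes "0 \<le> d" "d < CARD('n)"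
  obtains B :: real where "0 \<le> B"
    "\<And>t x. 0 \<le> t \<Longrightarrow> t \<le> \<beta> / 2 \<Longrightarrow> integrable lborel (\<lambda>z. reg_incr x z * norm z powr (- (real CARD('n) + t)))"
    "\<And>t x. 0 \<le> t \<Longrightarrow> t \<le> \<beta> / 2 \<Longrightarrow> \<bar>reg_potential t x\<bar> \<le> B * (1 + norm x) powr (d - CARD('n))"
proof -
  let ?N = "real CARD('n)"
  obtain B :: real where B: "0 \<le> B"
    "\<And>w c x. weight_le d c w \<Longrightarrow> integrable lborel (\<lambda>z. reg_incr x z * w (norm z))"
    "\<And>w c x. weight_le d c w \<Longrightarrow>
      \<bar>LINT z|lborel. reg_incr x z * w (norm z)\<bar> \<le> c * B * (1 + norm x) powr (d - ?N)"
    using reg_incr_weight_integral[OF assms] by blast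
  have w: "weight_le d 1 (\<lambda>r. r powr (- (?N + t)))" if t: "0 \<le> t" "t \<le> \<beta> / 2" for t
  proof -
    have "r powr (- (?N + t)) \<le> r powr (- (?N + \<beta> / 2))" if "0 < r" "r < 1" for r
      using that t by (intro powr_mono') auto
    moreover have "r powr (- (?N + t)) \<le> r powr (d - ?N)" if "1 \<le> r" for r
      using that t assms by (intro powr_mono) auto
    ultimately show ?thesis
      by (simp add: weight_le_def)
  qed
  show thesis
  proof (rule that[OF B(1)])
    fix t x
    assume t: "0 \<le> t" "t \<le> \<beta> / 2"
    show "integrable lborel (\<lambda>z. reg_incr x z * norm z powr (- (?N + t)))"
      using B(2)[OF w[OF t]] .
    show "\<bar>reg_potential t x\<bar> \<le> B * (1 + norm x) powr (d - ?N)"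
      using B(3)[OF w[OF t]] by (simp add: reg_potential_def)
  qed
qed

lemma integrable_reg_incr_powr:
  assumes "0 \<le> t" "t \<le> \<beta> / 2"
  shows "integrable lborel (\<lambda>z. reg_incr x z * norm z powr (- (real CARD('n) + t)))"
  using reg_potential_bound[of 0] assms by auto

text \<open>The weight is now the difference \<open>|z|^(-N) (|z|^(-t) - 1)\<close>. Its logarithm is absorbed into the power
  \<open>|z|^(-\<beta>/4)\<close> near the origin, which is affordable for \<open>t \<le> \<beta>/4\<close>, and into \<open>|z|^d\<close> at infinity,
  which is where the loss in the decay comes from.\<close>

lemma reg_potential_diff_bound:
  fixes d :: real
  assumes "0 < d" "d < CARD('n)"
  obtains B :: real where "0 \<le> B"
    "\<And>t x. 0 \<le> t \<Longrightarrow> t \<le> \<beta> / 4 \<Longrightarrow> \<bar>reg_potential t x - reg_potential 0 x\<bar> \<le> t * B * (1 + norm x) powr (d - CARD('n))"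
proof -
  let ?N = "real CARD('n)"
  obtain B :: real where B: "0 \<le> B"
    "\<And>w c x. weight_le d c w \<Longrightarrow> integrable lborel (\<lambda>z. reg_incr x z * w (norm z))"
    "\<And>w c x. weight_le d c w \<Longrightarrow>
      \<bar>LINT z|lborel. reg_incr x z * w (norm z)\<bar> \<le> c * B * (1 + norm x) powr (d - ?N)"
    using reg_incr_weight_integral[OF less_imp_le] assms by blast
  \<comment> \<open>The constants of the two logarithm estimates, with exponents \<open>\<beta>/4\<close> and \<open>d\<close>.\<close>
  define c where "c = 4 / \<beta> + 1 / d"
  have c: "4 / \<beta> \<le> c" "1 / d \<le> c" "0 \<le> c"
    using assms beta_pos by (auto simp: c_def)
  have "\<bar>reg_potential t x - reg_potential 0 x\<bar> \<le> (t * c) * B * (1 + norm x) powr (d - ?N)" if t: "0 \<le> t" "t \<le> \<beta> / 4" for t x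
  proof -
    define w where "w r = r powr (- (?N + t)) - r powr (- (?N + 0))" for r :: real
    have w: "\<bar>w r\<bar> = r powr (- ?N) * \<bar>r powr (- t) - 1\<bar>" if "0 < r" for r
    proof -
      have "w r = r powr (- ?N) * (r powr (- t) - 1)"
        by (simp add: w_def right_diff_distrib flip: powr_add)
      then show ?thesis
        by (simp add: abs_mult)
    qed
    have "reg_potential t x - reg_potential 0 x = (LINT z|lborel. reg_incr x z * w (norm z))"
      unfolding reg_potential_def w_def right_diff_distrib
      using t beta_pos by (intro Bochner_Integration.integral_diff[symmetric] integrable_reg_incr_powr) auto
    also have "\<bar>\<dots>\<bar> \<le> (t * c) * B * (1 + norm x) powr (d - ?N)"
    proof (rule B(3), unfold weight_le_def, intro conjI allI impI)
      show "w \<in> borel_measurable borel"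
        unfolding w_def by measurable
      show "0 \<le> t * c"
        using t c by simp
      fix r :: real
      {
        assume "0 < r \<and> r < 1"
        then have r: "0 < r" "r < 1"
          by auto
        have "\<bar>w r\<bar> \<le> r powr (- ?N) * (t / (\<beta> / 4) * r powr (- (t + \<beta> / 4)))"
          unfolding w[OF r(1)] using r t beta_pos
          by (intro mult_left_mono abs_powr_minus_one_le_small) auto
        also have "\<dots> = t * (4 / \<beta>) * r powr (- (?N + (t + \<beta> / 4)))"
          by (simp add: powr_add[symmetric] algebra_simps)
        also have "\<dots> \<le> t * c * r powr (- (?N + \<beta> / 2))"
          using r t c beta_pos by (intro mult_mono powr_mono') auto
        finally show "\<bar>w r\<bar> \<le> t * c * r powr (- (?N + \<beta> / 2))" .
      next
        assume r: "1 \<le> r"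
        have "\<bar>w r\<bar> \<le> r powr (- ?N) * (t / d * r powr d)"
          unfolding w[OF less_le_trans[OF zero_less_one r]] using r t assms
          by (intro mult_left_mono abs_powr_minus_one_le_large) auto
        also have "\<dots> = t * (1 / d) * r powr (d - ?N)"
          by (simp add: powr_add[symmetric] algebra_simps)
        also have "\<dots> \<le> t * c * r powr (d - ?N)"
          using t c assms by (intro mult_mono) auto
        finally show "\<bar>w r\<bar> \<le> t * c * r powr (d - ?N)" .
      }
    qed
    finally show ?thesis .
  qed
  then show thesis
    using B(1) c by (intro that[of "c * B"]) (auto simp: mult.assoc)
qed

text \<open>Dominated convergence. While \<open>x\<close> stays in the ball of radius \<open>b\<close>, the increment vanishes for
  \<open>|z| \<ge> 1\<close> with \<open>|z| > R + b\<close>, so that there is a common integrable majorant.\<close>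

lemma continuous_reg_potential:
  assumes t: "0 \<le> t" "t \<le> \<beta> / 2"
  shows "continuous_on UNIV (reg_potential t)"
proof -
  let ?N = "real CARD('n)"
  obtain A where A: "0 \<le> A"
    "\<And>x z. norm z < 1 \<Longrightarrow> \<bar>reg_incr x z\<bar> \<le> (if norm x \<le> R + 1 then A * norm z powr \<beta> else 0)"
    "\<And>x z. 1 \<le> norm z \<Longrightarrow> \<bar>reg_incr x z\<bar> \<le> (if norm (x + z) \<le> R then A else 0)"
    using reg_incr_bound by blast
  have "continuous_on (ball 0 b) (reg_potential t)" for b
  proof (rule continuous_on_sequentiallyI)
    fix X :: "nat \<Rightarrow> real^'n" and a
    assume X: "\<forall>n. X n \<in> ball 0 b" and lim: "X \<longlonglongrightarrow> a"
    define m where "m z = indicator (ball 0 1) z * norm z powr (\<beta> / 2 - ?N) + indicator (cball 0 (R + b)) z"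
      for z :: "real^'n"
    have m: "integrable lborel m"
      unfolding m_def
    proof (intro Bochner_Integration.integrable_add)
      show "integrable lborel (\<lambda>z::real^'n. indicator (ball 0 1) z * norm z powr (\<beta> / 2 - ?N))"
        using has_bochner_integral_norm_powr_ball[of "\<beta> / 2", where 'a="real^'n"] beta_pos
        by (simp add: has_bochner_integral_iff)
      show "integrable lborel (indicator (cball 0 (R + b)) :: real^'n \<Rightarrow> real)"
        using emeasure_bounded_finite[of "cball (0::real^'n) (R + b)"]
        by (intro integrable_real_indicator) auto
    qed
    show "(\<lambda>n. reg_potential t (X n)) \<longlonglongrightarrow> reg_potential t a"
      unfolding reg_potential_def
    proof (rule integral_dominated_convergence)
      show "integrable lborel (\<lambda>z. A * m z)"
        using m by simp
      have "isCont u y" for y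
        using continuous_u by (simp add: continuous_on_eq_continuous_at)
      then have "(\<lambda>n. u (X n + z)) \<longlonglongrightarrow> u (a + z)" for z
        by (intro isCont_tendsto_compose[of _ u] tendsto_add lim tendsto_const)
      moreover from this[of 0] have "(\<lambda>n. u (X n)) \<longlonglongrightarrow> u a"
        by simp
      moreover have "isCont (signed_pow p) y" for y
        using continuous_on_signed_pow[OF p_gt_1 continuous_on_id, of UNIV]
        by (simp add: continuous_on_eq_continuous_at)
      ultimately have "(\<lambda>n. reg_incr (X n) z) \<longlonglongrightarrow> reg_incr a z" for z
        unfolding reg_incr_def
        by (auto intro!: tendsto_diff isCont_tendsto_compose[of _ "signed_pow p"])
      then show "AE z in lborel. (\<lambda>n. reg_incr (X n) z * norm z powr (- (?N + t))) \<longlonglongrightarrow> reg_incr a z * norm z powr (- (?N + t))"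
        by (intro AE_I2 tendsto_mult tendsto_const)
      fix n
      have "\<bar>reg_incr (X n) z * norm z powr (- (?N + t))\<bar> \<le> A * m z" for z
      proof (cases "z = 0 \<or> 1 \<le> norm z \<and> norm (X n + z) > R")
        case True
        then have "reg_incr (X n) z = 0"
          using A(3)[of z "X n"] by (auto simp: reg_incr_def)
        then show ?thesis
          using A(1) by (simp add: m_def)
      next
        case False
        show ?thesis
        proof (cases "norm z < 1")
          case True
          have "\<bar>reg_incr (X n) z * norm z powr (- (?N + t))\<bar> \<le> (A * norm z powr \<beta>) * norm z powr (- (?N + \<beta> / 2))"
            unfolding abs_mult using True False A(1) A(2)[OF True, of "X n"] t
            by (intro mult_mono) (auto intro!: powr_mono' split: if_splits)
          also have "\<dots> = A * norm z powr (\<beta> / 2 - ?N)"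
            by (simp flip: powr_add)
          also have "\<dots> \<le> A * m z"
            using True A(1) by (intro mult_left_mono) (auto simp: m_def)
          finally show ?thesis .
        next
          case z: False
          have "norm (X n) < b"
            using X by simp
          then have "norm z \<le> R + b"
            using False z norm_triangle_ineq4[of "X n + z" "X n"] by simp
          then have zm: "1 \<le> m z"
            by (simp add: m_def)
          have "\<bar>reg_incr (X n) z * norm z powr (- (?N + t))\<bar> \<le> A * 1"
            unfolding abs_mult using z A(1) A(3)[of z "X n"] t powr_mono[of "- (?N + t)" 0 "norm z"]
            by (intro mult_mono) (auto split: if_splits)
          also have "\<dots> \<le> A * m z"
            using zm A(1) by (intro mult_left_mono)
          finally show ?thesis .
        qed
      qed
      then show "AE z in lborel. norm (reg_incr (X n) z * norm z powr (- (?N + t))) \<le> A * m z"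
        by simp
    qed measurable
  qed
  then have "continuous_on (\<Union>b. ball 0 b) (reg_potential t)"
    by (intro continuous_on_open_UN) auto
  moreover have "(\<Union>b. ball 0 b) = (UNIV :: (real^'n) set)"
    by (auto intro: gt_ex)
  ultimately show ?thesis
    by simp
qed

section \<open>The difference quotient\<close>

text \<open>After the translation \<open>y = x + z\<close>, the integrand is the regularized one plus \<open>g(u x) |z|^(-N-sp)\<close> on
  \<open>|z| \<ge> 1\<close>. In particular it is integrable across the singularity.\<close>

lemma has_bochner_integral_frac_integrand:
  assumes s: "0 < s" "s * p \<le> \<beta> / 2"
  shows "has_bochner_integral lebesgue (frac_integrand s p u x)
    (reg_potential (s * p) x + signed_pow p (u x) * (CARD('n) * unit_ball_vol CARD('n) / (s * p)))"
proof (rule has_bochner_integral_lebesgue_translate)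
  let ?N = "real CARD('n)"
  have sp: "0 < s * p"
    using s p_gt_1 by simp
  show "frac_integrand s p u x \<in> borel_measurable borel"
    unfolding frac_integrand_def by measurable
  have "has_bochner_integral lborel (\<lambda>z. reg_incr x z * norm z powr (- (?N + s * p))) (reg_potential (s * p) x)"
    using integrable_reg_incr_powr[of "s * p"] s sp by (simp add: reg_potential_def has_bochner_integral_iff)
  moreover have "has_bochner_integral lborel
      (\<lambda>z::real^'n. signed_pow p (u x) * (indicator (- ball 0 1) z * norm z powr (- (?N + s * p))))
      (signed_pow p (u x) * (?N * unit_ball_vol ?N / (s * p)))"
    using has_bochner_integral_norm_powr_Compl_ball[OF sp, where 'a="real^'n"]
    by (intro has_bochner_integral_mult_right) simp
  ultimately have "has_bochner_integral lborel
      (\<lambda>z. reg_incr x z * norm z powr (- (?N + s * p)) +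
        signed_pow p (u x) * (indicator (- ball 0 1) z * norm z powr (- (?N + s * p))))
      (reg_potential (s * p) x + signed_pow p (u x) * (?N * unit_ball_vol ?N / (s * p)))"
    by (rule has_bochner_integral_add)
  also have "(\<lambda>z. reg_incr x z * norm z powr (- (?N + s * p)) +
        signed_pow p (u x) * (indicator (- ball 0 1) z * norm z powr (- (?N + s * p))))
      = (\<lambda>z. frac_integrand s p u x (x + z))"
  proof
    fix z
    have "frac_integrand s p u x (x + z) = signed_pow p (u x - u (x + z)) * norm z powr (- (?N + s * p))"
      unfolding frac_integrand_def powr_minus_divide by simp
    then show "reg_incr x z * norm z powr (- (?N + s * p)) +
        signed_pow p (u x) * (indicator (- ball 0 1) z * norm z powr (- (?N + s * p)))
      = frac_integrand s p u x (x + z)"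
      by (simp add: reg_incr_def left_diff_distrib indicator_def)
  qed
  finally show "has_bochner_integral lborel (\<lambda>z. frac_integrand s p u x (x + z))
      (reg_potential (s * p) x + signed_pow p (u x) * (?N * unit_ball_vol ?N / (s * p)))" .
qed

lemma frac_p_laplacian_exists_small:
  assumes s: "0 < s" "s * p \<le> \<beta> / 2"
  shows "frac_p_laplacian_exists s p u x"
  using principal_value_integrable[of "frac_integrand s p u x" x] has_bochner_integral_frac_integrand[OF s, of x]
  unfolding frac_p_laplacian_exists_def has_bochner_integral_iff by blast

text \<open>The part that diverges as \<open>s \<rightarrow> 0\<close> contributes \<open>s c(s) g(u x) / (s c(0))\<close>. Subtracting \<open>g(u x)\<close> and dividing by \<open>s\<close>
  leaves the difference quotient of \<open>c(s)/c(0)\<close> at \<open>0\<close>.\<close>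

lemma frac_diff_quot_eq:
  assumes s: "0 < s" "s \<le> 1 / 2" "s * p \<le> \<beta> / 2"
  shows "frac_diff_quot p u s x = frac_coeff CARD('n) p s * reg_potential (s * p) x +
    (frac_coeff CARD('n) p s / log_const CARD('n) p - 1) / s * signed_pow p (u x)"
proof -
  let ?N = "real CARD('n)" and ?g = "signed_pow p (u x)" and ?c = "frac_coeff CARD('n) p s"
  let ?I = "reg_potential (s * p) x + ?g * (?N * unit_ball_vol ?N / (s * p))"
  have v: "log_const CARD('n) p * (?N * unit_ball_vol ?N) = p"
    by (rule log_const_surface) simp
  then have lc: "log_const CARD('n) p \<noteq> 0"
    using p_gt_1 by auto
  have v': "?N * unit_ball_vol ?N / (s * p) = 1 / (s * log_const CARD('n) p)"
    using v lc p_gt_1 s by (simp add: field_simps)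
  have "((\<lambda>e. LINT y:(- ball x e)|lebesgue. frac_integrand s p u x y) \<longlongrightarrow> ?I) (at_right 0)"
    using principal_value_integrable(2)[of "frac_integrand s p u x" x] has_bochner_integral_frac_integrand[OF s(1,3), of x]
    unfolding has_bochner_integral_iff by simp
  then have "Lim (at_right 0) (\<lambda>e. LINT y:(- ball x e)|lebesgue. frac_integrand s p u x y) = ?I"
    by (intro tendsto_Lim) auto
  moreover have "frac_const CARD('n) s p = s * ?c"
    using s by (simp add: frac_const_def frac_coeff_def)
  ultimately have "frac_p_laplacian s p u x = s * ?c * (reg_potential (s * p) x + ?g * (1 / (s * log_const CARD('n) p)))"
    unfolding frac_p_laplacian_def v' by simp
  then show ?thesis
    using s lc by (simp add: frac_diff_quot_def field_simps)
qed

text \<open>The right-hand side of the integral representation, with its two integrals combined.\<close>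

definition log_formula :: "real^'n \<Rightarrow> real" where
  "log_formula x = log_const CARD('n) p * reg_potential 0 x + rho_const CARD('n) p * signed_pow p (u x)"

text \<open>A bounded function with bounded support is bounded by a multiple of every decaying weight.\<close>

lemma signed_pow_u_bound:
  fixes d :: real
  assumes "d \<le> CARD('n)"
  obtains B :: real where "0 \<le> B" "\<And>x. \<bar>signed_pow p (u x)\<bar> \<le> B * (1 + norm x) powr (d - CARD('n))"
proof -
  let ?e = "d - real CARD('n)"
  obtain U where U: "0 \<le> U" "\<And>x. \<bar>u x\<bar> \<le> U"
    using bounded_u by blast
  have "\<bar>signed_pow p (u x)\<bar> \<le> U powr (p - 1) / (1 + R) powr ?e * (1 + norm x) powr ?e" for x
  proof (cases "norm x \<le> R")
    case True
    have "(1 + R) powr ?e \<le> (1 + norm x) powr ?e"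
      using True assms by (intro powr_mono2') (auto intro: add_pos_nonneg)
    then have "1 \<le> (1 + norm x) powr ?e / (1 + R) powr ?e"
      using R_pos by simp
    moreover have "\<bar>signed_pow p (u x)\<bar> \<le> U powr (p - 1)"
      unfolding abs_signed_pow using p_gt_1 by (intro powr_mono2 U) auto
    ultimately have "\<bar>signed_pow p (u x)\<bar> * 1 \<le> U powr (p - 1) * ((1 + norm x) powr ?e / (1 + R) powr ?e)"
      by (intro mult_mono) auto
    then show ?thesis
      by simp
  qed (simp add: zero_outside)
  then show thesis
    by (intro that[of "U powr (p - 1) / (1 + R) powr ?e"]) auto
qed

lemma continuous_log_formula: "continuous_on UNIV log_formula"
  unfolding log_formula_def[abs_def] using beta_pos
  by (intro continuous_intros continuous_reg_potential continuous_u p_gt_1) auto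

lemma log_formula_bound:
  fixes d :: real
  assumes "0 \<le> d" "d < CARD('n)"
  obtains B :: real where "0 \<le> B" "\<And>x. \<bar>log_formula x\<bar> \<le> B * (1 + norm x) powr (d - CARD('n))"
proof -
  let ?W = "\<lambda>x::real^'n. (1 + norm x) powr (d - real CARD('n))"
  let ?l = "log_const CARD('n) p" and ?r = "rho_const CARD('n) p"
  obtain B1 where B1: "0 \<le> B1" "\<And>t x. 0 \<le> t \<Longrightarrow> t \<le> \<beta> / 2 \<Longrightarrow> \<bar>reg_potential t x\<bar> \<le> B1 * ?W x"
    using reg_potential_bound[of d] assms by metis
  obtain B2 where B2: "0 \<le> B2" "\<And>x. \<bar>signed_pow p (u x)\<bar> \<le> B2 * ?W x"
    using signed_pow_u_bound[of d] assms by (metis less_imp_le)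
  have "\<bar>log_formula x\<bar> \<le> (\<bar>?l\<bar> * B1 + \<bar>?r\<bar> * B2) * ?W x" for x
  proof -
    have "\<bar>log_formula x\<bar> \<le> \<bar>?l\<bar> * \<bar>reg_potential 0 x\<bar> + \<bar>?r\<bar> * \<bar>signed_pow p (u x)\<bar>"
      unfolding log_formula_def by (rule order_trans[OF abs_triangle_ineq]) (simp add: abs_mult)
    also have "\<dots> \<le> \<bar>?l\<bar> * (B1 * ?W x) + \<bar>?r\<bar> * (B2 * ?W x)"
      using B1(2)[of 0 x] B2(2)[of x] beta_pos by (intro add_mono mult_left_mono) auto
    finally show ?thesis
      by (simp add: algebra_simps)
  qed
  then show thesis
    using B1 B2 by (intro that[of "\<bar>?l\<bar> * B1 + \<bar>?r\<bar> * B2"]) auto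
qed

text \<open>The range of orders in which all estimates hold: \<open>s \<le> 1/2\<close> selects the branch of the normalization
  constant, and \<open>s p \<le> \<beta>/4\<close> is the requirement of the difference estimate.\<close>

lemma eventually_small_order:
  "\<forall>\<^sub>F s in at_right 0. 0 < s \<and> s \<le> 1 / 2 \<and> s * p \<le> \<beta> / 4"
proof -
  have "\<forall>\<^sub>F s in at_right 0. s < min (1 / 2) (\<beta> / 4 / p)"
    using beta_pos p_gt_1 by (intro eventually_at_rightI[of 0 "min (1 / 2) (\<beta> / 4 / p)"]) auto
  then show ?thesis
    using eventually_at_right_less[of 0]
    by eventually_elim (use p_gt_1 in \<open>auto simp: field_simps\<close>)
qed

text \<open>The error splits as
  \<open>c(s) (P(s p) - P(0)) + (c(s) - c(0)) P(0) + (k(s) - \<rho>) g(u x)\<close>, where \<open>P\<close> is the regularized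
  potential and \<open>k(s)\<close> is the difference quotient of \<open>c/c(0)\<close>. In each term a factor that depends on
  \<open>s\<close> alone tends to \<open>0\<close>, and the rest is bounded by the weight.\<close>

lemma frac_diff_quot_rate:
  fixes d :: real
  assumes d: "0 < d" "d < CARD('n)"
  obtains \<epsilon> :: "real \<Rightarrow> real" where "\<And>s. 0 \<le> \<epsilon> s" "(\<epsilon> \<longlongrightarrow> 0) (at_right 0)"
    "\<forall>\<^sub>F s in at_right 0. \<forall>x. \<bar>frac_diff_quot p u s x - log_formula x\<bar> \<le> \<epsilon> s * (1 + norm x) powr (d - CARD('n))"
proof -
  let ?W = "\<lambda>x::real^'n. (1 + norm x) powr (d - real CARD('n))"
  let ?l = "log_const CARD('n) p" and ?r = "rho_const CARD('n) p"
  let ?c = "frac_coeff CARD('n) p"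
  obtain B1 where B1: "0 \<le> B1" "\<And>t x. 0 \<le> t \<Longrightarrow> t \<le> \<beta> / 2 \<Longrightarrow> \<bar>reg_potential t x\<bar> \<le> B1 * ?W x"
    using reg_potential_bound[of d] d by (metis less_imp_le)
  obtain B2 where B2: "0 \<le> B2" "\<And>x. \<bar>signed_pow p (u x)\<bar> \<le> B2 * ?W x"
    using signed_pow_u_bound[of d] d by (metis less_imp_le)
  obtain B3 where B3: "0 \<le> B3" "\<And>t x. 0 \<le> t \<Longrightarrow> t \<le> \<beta> / 4 \<Longrightarrow> \<bar>reg_potential t x - reg_potential 0 x\<bar> \<le> t * B3 * ?W x"
    using reg_potential_diff_bound[OF d] by blast
  have l: "?l \<noteq> 0"
    using log_const_surface[of "CARD('n)" p] p_gt_1 by auto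
  define k where "k s = (?c s / ?l - 1) / s" for s
  define \<epsilon> where "\<epsilon> s = \<bar>?c s\<bar> * (\<bar>s\<bar> * p * B3) + \<bar>?c s - ?l\<bar> * B1 + \<bar>k s - ?r\<bar> * B2" for s
  have c: "(?c has_real_derivative ?l * ?r) (at 0)"
    by (intro DERIV_frac_coeff) simp
  then have "(?c \<longlongrightarrow> ?c 0) (at 0)"
    by (meson DERIV_isCont isCont_def)
  then have c_lim: "(?c \<longlongrightarrow> ?l) (at_right 0)"
    unfolding frac_coeff_0 by (rule filterlim_mono) (auto simp: at_le)
  have "((\<lambda>s. ?c s / ?l) has_real_derivative ?r) (at 0)"
    using DERIV_cdivide[OF c, of ?l] l by simp
  then have "((\<lambda>s. (?c s / ?l - 1) / s) \<longlongrightarrow> ?r) (at 0)"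
    unfolding has_field_derivative_iff using l by (simp add: frac_coeff_0)
  then have k_lim: "(k \<longlongrightarrow> ?r) (at_right 0)"
    unfolding k_def by (rule filterlim_mono) (auto simp: at_le)
  have "(\<epsilon> \<longlongrightarrow> \<bar>?l\<bar> * (\<bar>0\<bar> * p * B3) + \<bar>?l - ?l\<bar> * B1 + \<bar>?r - ?r\<bar> * B2) (at_right 0)"
    unfolding \<epsilon>_def by (intro tendsto_intros c_lim k_lim)
  then have "(\<epsilon> \<longlongrightarrow> 0) (at_right 0)"
    by simp
  moreover have "0 \<le> \<epsilon> s" for s
    using B1 B2 B3 p_gt_1 by (simp add: \<epsilon>_def)
  moreover have "\<forall>\<^sub>F s in at_right 0. \<forall>x. \<bar>frac_diff_quot p u s x - log_formula x\<bar> \<le> \<epsilon> s * ?W x"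
    using eventually_small_order
  proof eventually_elim
    case (elim s)
    show ?case
    proof
      fix x
      have sp: "0 \<le> s * p"
        using elim p_gt_1 by simp
      have "frac_diff_quot p u s x - log_formula x
          = ?c s * (reg_potential (s * p) x - reg_potential 0 x) + (?c s - ?l) * reg_potential 0 x + (k s - ?r) * signed_pow p (u x)"
        using elim beta_pos by (subst frac_diff_quot_eq) (auto simp: log_formula_def k_def algebra_simps)
      also have "\<bar>\<dots>\<bar> \<le> \<bar>?c s\<bar> * \<bar>reg_potential (s * p) x - reg_potential 0 x\<bar> + \<bar>?c s - ?l\<bar> * \<bar>reg_potential 0 x\<bar> + \<bar>k s - ?r\<bar> * \<bar>signed_pow p (u x)\<bar>"
        unfolding abs_mult[symmetric] by linarith
      also have "\<dots> \<le> \<bar>?c s\<bar> * (s * p * B3 * ?W x) + \<bar>?c s - ?l\<bar> * (B1 * ?W x) + \<bar>k s - ?r\<bar> * (B2 * ?W x)"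
        using B1(2)[of 0 x] B2(2)[of x] B3(2)[of "s * p" x] elim sp beta_pos
        by (intro add_mono mult_left_mono) auto
      also have "\<dots> = \<epsilon> s * ?W x"
        using elim by (simp add: \<epsilon>_def algebra_simps)
      finally show "\<bar>frac_diff_quot p u s x - log_formula x\<bar> \<le> \<epsilon> s * ?W x" .
    qed
  qed
  ultimately show thesis
    by (intro that[of \<epsilon>])
qed

text \<open>The rate for any admissible \<open>d\<close> contains the pointwise limit; \<open>d = 1/2\<close> is admissible in every
  dimension.\<close>

lemma frac_diff_quot_tendsto: "((\<lambda>s. frac_diff_quot p u s x) \<longlongrightarrow> log_formula x) (at_right 0)"
proof -
  have "0 < (1 / 2 :: real)" "1 / 2 < real CARD('n)"
    using zero_less_card_finite[where 'a='n] by linarith+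
  then obtain \<epsilon> :: "real \<Rightarrow> real" where "(\<epsilon> \<longlongrightarrow> 0) (at_right 0)"
    and *: "\<forall>\<^sub>F s in at_right 0. \<forall>x. \<bar>frac_diff_quot p u s x - log_formula x\<bar> \<le> \<epsilon> s * (1 + norm x) powr (1 / 2 - real CARD('n))"
    using frac_diff_quot_rate[of "1 / 2"] by blast
  then have "((\<lambda>s. \<epsilon> s * (1 + norm x) powr (1 / 2 - real CARD('n))) \<longlongrightarrow> 0) (at_right 0)"
    by (intro tendsto_mult_left_zero)
  then have "((\<lambda>s. frac_diff_quot p u s x - log_formula x) \<longlongrightarrow> 0) (at_right 0)"
    by (rule Lim_null_comparison[rotated]) (use * in \<open>auto elim: eventually_mono\<close>)
  then show ?thesis
    by (simp add: Lim_null[of _ "log_formula x"])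
qed

lemma log_p_laplacian_eq: "log_p_laplacian p u = log_formula"
  unfolding log_p_laplacian_def
  by (intro ext tendsto_Lim frac_diff_quot_tendsto) simp

lemma reg_potential_0_split:
  shows "set_integrable lebesgue (ball x 1) (\<lambda>y. signed_pow p (u x - u y) / norm (x - y) ^ CARD('n))"
    and "set_integrable lebesgue (- ball x 1)
      (\<lambda>y. (signed_pow p (u x - u y) - signed_pow p (u x)) / norm (x - y) ^ CARD('n))"
    and "reg_potential 0 x = (LINT y:ball x 1|lebesgue. signed_pow p (u x - u y) / norm (x - y) ^ CARD('n)) +
      (LINT y:(- ball x 1)|lebesgue. (signed_pow p (u x - u y) - signed_pow p (u x)) / norm (x - y) ^ CARD('n))"
proof -
  let ?A = "ball x 1" and ?f = "\<lambda>y. signed_pow p (u x - u y) / norm (x - y) ^ CARD('n)"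
  let ?B = "- ball x 1" and ?g = "\<lambda>y. (signed_pow p (u x - u y) - signed_pow p (u x)) / norm (x - y) ^ CARD('n)"
  let ?k = "\<lambda>z. reg_incr x z * norm z powr (- (real CARD('n) + 0))"
  have k: "integrable lborel ?k"
    using integrable_reg_incr_powr[of 0] beta_pos by simp
  have pw: "norm z powr (- real CARD('n)) = 1 / norm z ^ CARD('n)" if "z \<noteq> 0" for z :: "real^'n"
    using that by (simp add: powr_minus_divide powr_realpow)
  have "(\<lambda>y. indicator ?A y *\<^sub>R ?f y) \<in> borel_measurable borel"
    by (intro borel_measurable_scaleR borel_measurable_indicator) (simp, measurable)
  moreover have "indicator ?A (x + z) *\<^sub>R ?f (x + z) = indicator (ball 0 1) z *\<^sub>R ?k z" for z
    by (cases "z = 0") (auto simp: indicator_def reg_incr_def pw dist_norm)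
  ultimately have 1: "has_bochner_integral lebesgue (\<lambda>y. indicator ?A y *\<^sub>R ?f y)
      (LINT z|lborel. indicator (ball 0 1) z *\<^sub>R ?k z)"
    using integrable_mult_indicator[OF _ k, of "ball 0 1"]
    by (intro has_bochner_integral_lebesgue_translate[where x = x]) (simp_all add: has_bochner_integral_iff)
  have "(\<lambda>y. indicator ?B y *\<^sub>R ?g y) \<in> borel_measurable borel"
    by (intro borel_measurable_scaleR borel_measurable_indicator) (simp, measurable)
  moreover have "indicator ?B (x + z) *\<^sub>R ?g (x + z) = indicator (- ball 0 1) z *\<^sub>R ?k z" for z
    by (cases "z = 0") (auto simp: indicator_def reg_incr_def pw dist_norm)
  ultimately have 2: "has_bochner_integral lebesgue (\<lambda>y. indicator ?B y *\<^sub>R ?g y)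
      (LINT z|lborel. indicator (- ball 0 1) z *\<^sub>R ?k z)"
    using integrable_mult_indicator[OF _ k, of "- ball 0 1"]
    by (intro has_bochner_integral_lebesgue_translate[where x = x]) (simp_all add: has_bochner_integral_iff)
  show "set_integrable lebesgue ?A ?f" "set_integrable lebesgue ?B ?g"
    using 1 2 unfolding set_integrable_def has_bochner_integral_iff by blast+
  have "reg_potential 0 x = (LINT z|lborel. indicator (ball 0 1) z *\<^sub>R ?k z + indicator (- ball 0 1) z *\<^sub>R ?k z)"
    unfolding reg_potential_def by (intro Bochner_Integration.integral_cong) (auto simp: indicator_def)
  also have "\<dots> = (LINT z|lborel. indicator (ball 0 1) z *\<^sub>R ?k z) + (LINT z|lborel. indicator (- ball 0 1) z *\<^sub>R ?k z)"
    using k by (intro Bochner_Integration.integral_add integrable_mult_indicator) auto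
  finally show "reg_potential 0 x = (LINT y:?A|lebesgue. ?f y) + (LINT y:?B|lebesgue. ?g y)"
    using 1 2 unfolding set_lebesgue_integral_def has_bochner_integral_iff by metis
qed

section \<open>Convergence in \<open>L^q\<close>\<close>

text \<open>The weighted rate is used with the exponent belonging to \<open>q\<close>. The
  difference quotients are measurable because the regularized potential is continuous.\<close>

lemma tendsto_Lq_frac_diff_quot:
  fixes q :: ennreal
  assumes "1 < q"
  shows "tendsto_Lq q (frac_diff_quot p u) log_formula (at_right 0)"
proof -
  obtain d K :: real where d: "0 < d" "d < CARD('n)" and K: "0 \<le> K"
    "\<And>e (f :: real^'n \<Rightarrow> real). f \<in> borel_measurable lebesgue \<Longrightarrow> 0 \<le> e
      \<Longrightarrow> (\<And>x. \<bar>f x\<bar> \<le> e * (1 + norm x) powr (d - CARD('n))) \<Longrightarrow> Lq_norm q f \<le> ennreal (K * e)"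
    using Lq_norm_le_decay[OF assms, where 'n='n] by blast
  let ?W = "\<lambda>x::real^'n. (1 + norm x) powr (d - real CARD('n))"
  obtain B where B: "0 \<le> B" "\<And>x. \<bar>log_formula x\<bar> \<le> B * ?W x"
    using log_formula_bound[of d] d by (metis less_imp_le)
  obtain \<epsilon> :: "real \<Rightarrow> real" where \<epsilon>: "\<And>s. 0 \<le> \<epsilon> s" "(\<epsilon> \<longlongrightarrow> 0) (at_right 0)"
    "\<forall>\<^sub>F s in at_right 0. \<forall>x. \<bar>frac_diff_quot p u s x - log_formula x\<bar> \<le> \<epsilon> s * ?W x"
    using frac_diff_quot_rate[OF d] by blast
  have lebesgueI: "f \<in> borel_measurable lebesgue" if "continuous_on UNIV f" for f :: "real^'n \<Rightarrow> real"
    using borel_measurable_continuous_onI[OF that] by (simp add: measurable_completion)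
  have mL [measurable]: "log_formula \<in> borel_measurable lebesgue"
    by (rule lebesgueI[OF continuous_log_formula])
  have "\<forall>\<^sub>F s in at_right 0. frac_diff_quot p u s \<in> borel_measurable lebesgue"
    using eventually_small_order
  proof eventually_elim
    case (elim s)
    have "continuous_on UNIV (\<lambda>x. frac_coeff CARD('n) p s * reg_potential (s * p) x +
        (frac_coeff CARD('n) p s / log_const CARD('n) p - 1) / s * signed_pow p (u x))"
      using elim beta_pos p_gt_1 by (intro continuous_intros continuous_reg_potential continuous_u) auto
    also have "(\<lambda>x. frac_coeff CARD('n) p s * reg_potential (s * p) x +
        (frac_coeff CARD('n) p s / log_const CARD('n) p - 1) / s * signed_pow p (u x)) = frac_diff_quot p u s"
      using elim beta_pos by (intro ext frac_diff_quot_eq[symmetric]) auto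
    finally show ?case
      by (rule lebesgueI)
  qed
  then have "\<forall>\<^sub>F s in at_right 0. frac_diff_quot p u s \<in> Lq_space q \<and>
      Lq_norm q (\<lambda>x. frac_diff_quot p u s x - log_formula x) \<le> ennreal (K * \<epsilon> s)"
    using \<epsilon>(3)
  proof eventually_elim
    case (elim s)
    note [measurable] = elim(1)
    have "\<bar>frac_diff_quot p u s x\<bar> \<le> (\<epsilon> s + B) * ?W x" for x
      using elim(2)[rule_format, of x] B(2)[of x] by (simp add: distrib_right)
    then have "Lq_norm q (frac_diff_quot p u s) \<le> ennreal (K * (\<epsilon> s + B))"
      using B(1) \<epsilon>(1)[of s] by (intro K(2)) auto
    then have "Lq_norm q (frac_diff_quot p u s) < \<infinity>"
      using order_le_less_trans by force
    moreover have "Lq_norm q (\<lambda>x. frac_diff_quot p u s x - log_formula x) \<le> ennreal (K * \<epsilon> s)"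
      using elim(2) \<epsilon>(1)[of s] by (intro K(2)) auto
    ultimately show ?case
      by (simp add: Lq_space_def)
  qed
  then have ev: "\<forall>\<^sub>F s in at_right 0. frac_diff_quot p u s \<in> Lq_space q"
      "\<forall>\<^sub>F s in at_right 0. Lq_norm q (\<lambda>x. frac_diff_quot p u s x - log_formula x) \<le> ennreal (K * \<epsilon> s)"
    by (simp_all add: eventually_conj_iff)
  have "Lq_norm q log_formula \<le> ennreal (K * B)"
    using B by (intro K(2)) auto
  then have memb: "log_formula \<in> Lq_space q"
    unfolding Lq_space_def using order_le_less_trans by force
  have "((\<lambda>s. ennreal (K * \<epsilon> s)) \<longlongrightarrow> ennreal (K * 0)) (at_right 0)"
    by (intro tendsto_ennrealI tendsto_intros \<epsilon>(2))
  then have "((\<lambda>s. Lq_norm q (\<lambda>x. frac_diff_quot p u s x - log_formula x)) \<longlongrightarrow> 0) (at_right 0)"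
    by (intro tendsto_sandwich[OF always_eventually ev(2) tendsto_const]) simp_all
  then show ?thesis
    unfolding tendsto_Lq_def using ev(1) memb by simp
qed

end

text \<open>The empty list of partial derivatives gives the Hoelder continuity of \<open>u\<close> itself, with exponent
  \<open>\<sigma>\<close> rather than \<open>\<alpha>\<close>.\<close>

lemma Cc_holder_holder_compact_support:
  assumes "1 < p" "u \<in> Cc_holder \<alpha>"
  obtains \<sigma> C R where "holder_compact_support u p \<sigma> C R"
proof -
  obtain k \<sigma> where "0 < \<sigma>" and h: "\<And>is. length is \<le> k \<Longrightarrow> holder_continuous \<sigma> (iter_partial is u)"
    using assms(2) by (auto simp: Cc_holder_def)
  have "holder_continuous \<sigma> u"
    using h[of "[]"] by (simp add: iter_partial_def)
  then obtain C where C: "\<And>x y. \<bar>u x - u y\<bar> \<le> C * dist x y powr \<sigma>"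
    by (auto simp: holder_continuous_def)
  have "bounded (closure {x. u x \<noteq> 0})"
    using assms(2) by (auto simp: Cc_holder_def intro: compact_imp_bounded)
  then obtain R where R: "0 < R" "\<And>x. u x \<noteq> 0 \<Longrightarrow> norm x \<le> R"
    by (metis (mono_tags, lifting) bounded_pos closure_subset mem_Collect_eq subset_iff)
  have "\<bar>u x - u y\<bar> \<le> \<bar>C\<bar> * dist x y powr \<sigma>" for x y
    using C[of x y] by (rule order_trans) (intro mult_right_mono; simp)
  with assms(1) \<open>0 < \<sigma>\<close> R show thesis
    by (intro that[of \<sigma> "\<bar>C\<bar>" R]) (unfold_locales, auto simp: not_le[symmetric])
qed

theorem theorem1p1:
  fixes u :: "real^'n::finite \<Rightarrow> real" and p \<alpha> :: real
  assumes "1 < p" and "0 < \<alpha>" and "u \<in> Cc_holder \<alpha>"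
  shows
    "(\<forall>\<^sub>F s in at_right 0. \<forall>x. frac_p_laplacian_exists s p u x) \<and>
     (\<forall>x.
        ((\<lambda>s. frac_diff_quot p u s x) \<longlongrightarrow> log_p_laplacian p u x) (at_right 0) \<and>
        set_integrable lebesgue (ball x 1)
          (\<lambda>y. signed_pow p (u x - u y) / norm (x - y) ^ CARD('n)) \<and>
        set_integrable lebesgue (- ball x 1)
          (\<lambda>y. (signed_pow p (u x - u y) - signed_pow p (u x)) / norm (x - y) ^ CARD('n)) \<and>
        log_p_laplacian p u x =
          log_const CARD('n) p *
            (LINT y:ball x 1|lebesgue. signed_pow p (u x - u y) / norm (x - y) ^ CARD('n)) +
          log_const CARD('n) p *
            (LINT y:(- ball x 1)|lebesgue.
               (signed_pow p (u x - u y) - signed_pow p (u x)) / norm (x - y) ^ CARD('n)) +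
          rho_const CARD('n) p * signed_pow p (u x)) \<and>
     (\<forall>q::ennreal. 1 < q \<longrightarrow>
        log_p_laplacian p u \<in> Lq_space q \<and>
        continuous_on UNIV (log_p_laplacian p u) \<and>
        tendsto_Lq q (frac_diff_quot p u) (log_p_laplacian p u) (at_right 0))"
proof -
  obtain \<sigma> C R where "holder_compact_support u p \<sigma> C R"
    using Cc_holder_holder_compact_support[OF assms(1,3)] by blast
  then interpret holder_compact_support u p \<sigma> C R .
  show ?thesis
    unfolding log_p_laplacian_eq
  proof (intro conjI allI impI)
    show "\<forall>\<^sub>F s in at_right 0. \<forall>x. frac_p_laplacian_exists s p u x"
      using eventually_small_order
      by eventually_elim (use beta_pos in \<open>auto intro!: frac_p_laplacian_exists_small\<close>)
    fix x
    show "log_formula x = log_const CARD('n) p *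
        (LINT y:ball x 1|lebesgue. signed_pow p (u x - u y) / norm (x - y) ^ CARD('n)) +
      log_const CARD('n) p *
        (LINT y:(- ball x 1)|lebesgue.
           (signed_pow p (u x - u y) - signed_pow p (u x)) / norm (x - y) ^ CARD('n)) +
      rho_const CARD('n) p * signed_pow p (u x)"
      using log_formula_def[of x] reg_potential_0_split(3)[of x] by (simp only: distrib_left)
  next
    fix q :: ennreal
    assume "1 < q"
    then show "tendsto_Lq q (frac_diff_quot p u) log_formula (at_right 0)"
      by (rule tendsto_Lq_frac_diff_quot)
    then show "log_formula \<in> Lq_space q"
      by (simp add: tendsto_Lq_def)
  qed (rule frac_diff_quot_tendsto reg_potential_0_split continuous_log_formula)+
qed

end
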